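(* For $\alpha>2$ let $$D(\alpha)=\Big\{(z,w)\in\mathbb{C}^2:\ \big||w|^2-|z|^2\big|<r(z,w)^{-\alpha}\Big\},\qquad r(z,w)=1+|z|^2+|w|^2.$$ If $2<\alpha<3$, then the following hold: (i) the Bergman space of $D(\alpha)$ is $A^2(D(\alpha))=\mathrm{Span}_{\mathbb{C}}\{1,z,w\}$; (ii) the Bergman metric of $D(\alpha)$ has constant holomorphic sectional curvature $2$.
   Context: For a domain $D\subset\mathbb{C}^2$, $A^2(D)$ is the Hilbert space of holomorphic functions on $D$ that are square integrable with respect to Lebesgue measure, and $K_D=\sum_j|f_j|^2$ for an orthonormal basis $\{f_j\}$ of $A^2(D)$. When $K_D>0$ and $\omega_D=\sqrt{-1}\,\partial\overline\partial\log K_D$ is positive definite on $D$, $\omega_D$ is called the Bergman metric of $D$. Its metric tensor is $g_{\alpha\overline\beta}=\partial^2\log K_D/\partial z_\alpha\partial\overline z_\beta$ (coordinates $z_1=z$, $z_2=w$), with curvature $R_{i\overline jk\overline l}=-\partial_k\partial_{\overline l}g_{i\overline j}+\sum g^{\alpha\overline\beta}\,\partial_kg_{i\overline\beta}\,\partial_{\overline l}g_{\alpha\overline j}$; the holomorphic sectional curvature in the direction of a nonzero $(1,0)$-vector $X$ is $R(X,\overline X,X,\overline X)/g(X,\overline X)^2$ (so that the Fubini–Study metric $\sqrt{-1}\,\partial\overline\partial\log(1+|z|^2+|w|^2)$ has holomorphic sectional curvature $2$). *)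

theory Defs
  imports "HOL-Analysis.Analysis" "HOL-Library.Function_Algebras"
begin

text \<open>Holomorphy in several variables: the real (Frechet) derivative exists and is complex linear.\<close>

definition holomorphic_vec_on :: "(complex^'n \<Rightarrow> complex) \<Rightarrow> (complex^'n) set \<Rightarrow> bool" where
  "holomorphic_vec_on f D \<longleftrightarrow>
     (\<forall>p\<in>D. \<exists>f'. (f has_derivative f') (at p within D) \<and> (\<forall>c v. f' (c *s v) = c * f' v))"

text \<open>Functions on a domain \<open>D\<close> are represented by total functions that vanish outside \<open>D\<close>,
  so that two of them are equal iff they agree on \<open>D\<close>.\<close>

definition zero_ext :: "'a set \<Rightarrow> ('a \<Rightarrow> complex) \<Rightarrow> 'a \<Rightarrow> complex" where
  "zero_ext D f = (\<lambda>p. if p \<in> D then f p else 0)"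

definition bergman_space :: "(complex^'n) set \<Rightarrow> (complex^'n \<Rightarrow> complex) set" where
  "bergman_space D = {f. holomorphic_vec_on f D \<and>
                         set_integrable lborel D (\<lambda>p. (cmod (f p))\<^sup>2) \<and>
                         (\<forall>p. p \<notin> D \<longrightarrow> f p = 0)}"

interpretation cfun: vector_space "\<lambda>(c::complex) (f::'a \<Rightarrow> complex) p. c * f p"
  by unfold_locales (auto simp: fun_eq_iff algebra_simps)

abbreviation cspan :: "('a \<Rightarrow> complex) set \<Rightarrow> ('a \<Rightarrow> complex) set" where
  "cspan \<equiv> cfun.span"

definition l2_inner ::
    "(complex^'n) set \<Rightarrow> (complex^'n \<Rightarrow> complex) \<Rightarrow> (complex^'n \<Rightarrow> complex) \<Rightarrow> complex" where
  "l2_inner D f g = (LINT p:D|lborel. f p * cnj (g p))"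

definition l2_norm :: "(complex^'n) set \<Rightarrow> (complex^'n \<Rightarrow> complex) \<Rightarrow> real" where
  "l2_norm D f = sqrt (LINT p:D|lborel. (cmod (f p))\<^sup>2)"

text \<open>Orthonormal basis in the Hilbert space sense: an orthonormal set with dense linear span.\<close>

definition bergman_onb :: "(complex^'n) set \<Rightarrow> (complex^'n \<Rightarrow> complex) set \<Rightarrow> bool" where
  "bergman_onb D B \<longleftrightarrow> B \<subseteq> bergman_space D \<and>
     (\<forall>f\<in>B. \<forall>g\<in>B. l2_inner D f g = (if f = g then 1 else 0)) \<and>
     (\<forall>f\<in>bergman_space D. \<forall>e>0. \<exists>g\<in>cspan B. l2_norm D (f - g) < e)"

text \<open>For open \<open>D\<close> an orthonormal basis exists and the sum does not depend on the chosen one.\<close>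

definition bergman_kernel :: "(complex^'n) set \<Rightarrow> complex^'n \<Rightarrow> real" where
  "bergman_kernel D p = (\<Sum>\<^sub>\<infinity>f\<in>(SOME B. bergman_onb D B). (cmod (f p))\<^sup>2)"

text \<open>Wirtinger derivatives \<open>\<partial>/\<partial>z\<^sub>j = (\<partial>/\<partial>x\<^sub>j - \<i> \<partial>/\<partial>y\<^sub>j) / 2\<close> and
  \<open>\<partial>/\<partial>(cnj z\<^sub>j) = (\<partial>/\<partial>x\<^sub>j + \<i> \<partial>/\<partial>y\<^sub>j) / 2\<close>, where \<open>z\<^sub>j = x\<^sub>j + \<i> y\<^sub>j\<close>.\<close>

definition partial_x :: "'n \<Rightarrow> (complex^'n \<Rightarrow> complex) \<Rightarrow> complex^'n \<Rightarrow> complex" where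
  "partial_x j f p = vector_derivative (\<lambda>t. f (p + t *\<^sub>R axis j 1)) (at 0)"

definition partial_y :: "'n \<Rightarrow> (complex^'n \<Rightarrow> complex) \<Rightarrow> complex^'n \<Rightarrow> complex" where
  "partial_y j f p = vector_derivative (\<lambda>t. f (p + t *\<^sub>R axis j \<i>)) (at 0)"

definition d_z :: "'n \<Rightarrow> (complex^'n \<Rightarrow> complex) \<Rightarrow> complex^'n \<Rightarrow> complex" where
  "d_z j f p = (partial_x j f p - \<i> * partial_y j f p) / 2"

definition d_zbar :: "'n \<Rightarrow> (complex^'n \<Rightarrow> complex) \<Rightarrow> complex^'n \<Rightarrow> complex" where
  "d_zbar j f p = (partial_x j f p + \<i> * partial_y j f p) / 2"

text \<open>A (Hermitian) metric tensor is a matrix-valued function \<open>G\<close> whose entry \<open>G p $ i $ j\<close> is the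
  coefficient with index \<open>i\<close> holomorphic and index \<open>j\<close> antiholomorphic.\<close>

definition metric_form :: "(complex^'n \<Rightarrow> complex^'n^'n) \<Rightarrow> complex^'n \<Rightarrow> complex^'n \<Rightarrow> complex" where
  "metric_form G p X = (\<Sum>i\<in>UNIV. \<Sum>j\<in>UNIV. G p $ i $ j * X $ i * cnj (X $ j))"

definition metric_pos_def_on :: "(complex^'n \<Rightarrow> complex^'n^'n) \<Rightarrow> (complex^'n) set \<Rightarrow> bool" where
  "metric_pos_def_on G D \<longleftrightarrow>
     (\<forall>p\<in>D. \<forall>X. X \<noteq> 0 \<longrightarrow> metric_form G p X \<in> \<real> \<and> 0 < Re (metric_form G p X))"

text \<open>The raised-index tensor is normalised by the condition that summing
  \<open>inv_metric G p a b * G p $ c $ b\<close> over \<open>b\<close> gives the Kronecker delta of \<open>a\<close> and \<open>c\<close>; hence the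
  transposition.\<close>

definition inv_metric :: "(complex^'n \<Rightarrow> complex^'n^'n) \<Rightarrow> complex^'n \<Rightarrow> 'n \<Rightarrow> 'n \<Rightarrow> complex" where
  "inv_metric G p a b = matrix_inv (G p) $ b $ a"

definition curvature ::
    "(complex^'n \<Rightarrow> complex^'n^'n) \<Rightarrow> complex^'n \<Rightarrow> 'n \<Rightarrow> 'n \<Rightarrow> 'n \<Rightarrow> 'n \<Rightarrow> complex" where
  "curvature G p i j k l =
     - d_z k (d_zbar l (\<lambda>q. G q $ i $ j)) p
     + (\<Sum>a\<in>UNIV. \<Sum>b\<in>UNIV.
          inv_metric G p a b * d_z k (\<lambda>q. G q $ i $ b) p * d_zbar l (\<lambda>q. G q $ a $ j) p)"

definition hol_sect_curv :: "(complex^'n \<Rightarrow> complex^'n^'n) \<Rightarrow> complex^'n \<Rightarrow> complex^'n \<Rightarrow> complex" where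
  "hol_sect_curv G p X =
     (\<Sum>i\<in>UNIV. \<Sum>j\<in>UNIV. \<Sum>k\<in>UNIV. \<Sum>l\<in>UNIV.
        curvature G p i j k l * X $ i * cnj (X $ j) * X $ k * cnj (X $ l))
     / (metric_form G p X)\<^sup>2"

definition bergman_tensor :: "(complex^'n) set \<Rightarrow> complex^'n \<Rightarrow> complex^'n^'n" where
  "bergman_tensor D p =
     (\<chi> a b. d_z a (d_zbar b (\<lambda>q. complex_of_real (ln (bergman_kernel D q)))) p)"

definition has_bergman_metric :: "(complex^'n) set \<Rightarrow> bool" where
  "has_bergman_metric D \<longleftrightarrow>
     (\<forall>p\<in>D. 0 < bergman_kernel D p) \<and> metric_pos_def_on (bergman_tensor D) D"

text \<open>The coordinates of \<open>p :: complex^2\<close> are \<open>z = p $ 1\<close> and \<open>w = p $ 2\<close>.\<close>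

definition r_fun :: "complex^2 \<Rightarrow> real" where
  "r_fun p = 1 + (cmod (p $ 1))\<^sup>2 + (cmod (p $ 2))\<^sup>2"

definition D_alpha :: "real \<Rightarrow> (complex^2) set" where
  "D_alpha \<alpha> = {p. \<bar>(cmod (p $ 2))\<^sup>2 - (cmod (p $ 1))\<^sup>2\<bar> < r_fun p powr (- \<alpha>)}"

end

theory Submission
  imports Defs "HOL-Complex_Analysis.Conformal_Mappings"
begin

text \<open>Write \<open>D\<close> for the domain. It is open and balanced: shrinking \<open>p\<close> by a scalar of modulus at most 1 does not increase
  \<open>\<bar>\<bar>w\<bar>\<^sup>2 - \<bar>z\<bar>\<^sup>2\<bar>\<close> and does not decrease the bound \<open>r\<^sup>-\<^sup>\<alpha>\<close>. Hence a holomorphic \<open>f\<close> on \<open>D\<close> has an expansion into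
  homogeneous parts \<open>P\<^sub>m\<close>, the Taylor coefficients at 0 of \<open>\<lambda> \<mapsto> f (\<lambda> p)\<close>, and these are also Fourier
  coefficients of \<open>f\<close> along the circle through \<open>p\<close>. The circle action preserves Lebesgue measure and \<open>D\<close>, so by
  the Cauchy-Schwarz inequality the norm of \<open>P\<^sub>m\<close> is at most that of \<open>f\<close>
  (\<open>homog_part_L2_le\<close>).

  The width of \<open>D\<close> decides which degrees survive. In the coordinates \<open>(z, u)\<close> with \<open>w = z u\<close>, whose Jacobian is
  \<open>\<bar>z\<bar>\<^sup>2\<close>, the points over a large \<open>z\<close> fill the annulus on which \<open>\<bar>\<bar>u\<bar>\<^sup>2 - 1\<bar>\<close> is smaller than a quantity
  comparable to \<open>\<bar>z\<bar> powr (-2 - 2\<alpha>)\<close>, and \<open>P\<^sub>m (z, z u) = z ^ m * P\<^sub>m (1, u)\<close>. If \<open>P\<^sub>m (1, u)\<close> is not zero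
  at a point of the unit circle, the square of the norm of \<open>P\<^sub>m\<close> is therefore at least a positive multiple of
  the integral of \<open>\<bar>z\<bar> powr (2m - 2\<alpha>)\<close> over \<open>\<bar>z\<bar> \<ge> 1\<close>, which diverges if \<open>m \<ge> \<alpha> - 1\<close>, and so for all
  \<open>m \<ge> 2\<close> when \<open>\<alpha> < 3\<close> (\<open>nn_integral_homog_diverges\<close>). Thus a square integrable \<open>f\<close> agrees with its affine part
  wherever \<open>\<bar>z\<bar> = \<bar>w\<bar>\<close>, a set that determines holomorphic functions on \<open>D\<close>
  (\<open>holomorphic_vanishes_if_vanishes_on_diagonal\<close>). Conversely, the same coordinates show that affine
  functions are square integrable when \<open>\<alpha> > 2\<close>.

  So the Bergman space is spanned by \<open>1\<close>, \<open>z\<close>, \<open>w\<close>, which are mutually orthogonal because \<open>D\<close> is invariant under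
  changes of sign of \<open>z\<close> and of \<open>w\<close>. Consequently \<open>K = A + B\<^sub>1 \<bar>z\<bar>\<^sup>2 + B\<^sub>2 \<bar>w\<bar>\<^sup>2\<close> on \<open>D\<close> with positive
  constants. Up to a diagonal linear change of coordinates \<open>log K\<close> is the Fubini-Study potential; its curvature is
  computed directly in the locale \<open>quadratic_kernel\<close>.\<close>

section \<open>Lebesgue measure on products of complex lines\<close>

lemma measurable_Complex_borel [measurable]:
  assumes [measurable]: "f \<in> borel_measurable M" "g \<in> borel_measurable M"
  shows "(\<lambda>x. Complex (f x) (g x)) \<in> borel_measurable M"
  unfolding Complex_eq by measurable

lemma lborel_complex_eq: "(lborel :: complex measure) = distr (lborel \<Otimes>\<^sub>M lborel) borel (\<lambda>(x, y). Complex x y)"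
proof (rule lborel_eqI)
  have m[measurable]: "(\<lambda>(x, y). Complex x y) \<in> borel \<Otimes>\<^sub>M borel \<rightarrow>\<^sub>M borel" by measurable
  fix l u :: complex
  assume le: "\<And>b. b \<in> Basis \<Longrightarrow> l \<bullet> b \<le> u \<bullet> b"
  have le': "Re l \<le> Re u" "Im l \<le> Im u" using le[of 1] le[of \<i>] by (auto simp: Basis_complex_def)
  have "(\<lambda>(x, y). Complex x y) -` box l u \<inter> space (lborel \<Otimes>\<^sub>M lborel) = box (Re l) (Re u) \<times> box (Im l) (Im u)"
    by (auto simp: box_def Basis_complex_def space_pair_measure)
  then show "emeasure (distr (lborel \<Otimes>\<^sub>M lborel) borel (\<lambda>(x, y). Complex x y)) (box l u) = (\<Prod>b\<in>Basis. (u - l) \<bullet> b)"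
    using le' by (simp add: emeasure_distr lborel.emeasure_pair_measure_Times Basis_complex_def ennreal_mult)
qed simp

lemma nn_integral_lborel_complex:
  fixes g :: "complex \<Rightarrow> ennreal"
  assumes [measurable]: "g \<in> borel_measurable borel"
  shows "(\<integral>\<^sup>+z. g z \<partial>lborel) = (\<integral>\<^sup>+x. \<integral>\<^sup>+y. g (Complex x y) \<partial>lborel \<partial>lborel)"
  by (subst lborel_complex_eq, subst nn_integral_distr, simp, simp, subst lborel.nn_integral_fst[symmetric])
    (simp_all add: case_prod_unfold)

text \<open>The real linear map \<open>z \<mapsto> c z\<close> is a composition of two affine substitutions, each in one real variable with the other
  fixed; the factorization divides by \<open>Re c\<close>.\<close>

lemma nn_integral_complex_mult_aux:
  fixes g :: "complex \<Rightarrow> ennreal"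
  assumes [measurable]: "g \<in> borel_measurable borel" and c: "Re c \<noteq> 0"
  shows "(\<integral>\<^sup>+z. g z \<partial>lborel) = ennreal ((cmod c)\<^sup>2) * (\<integral>\<^sup>+z. g (c * z) \<partial>lborel)"
proof -
  define a b where "a = Re c" and "b = Im c"
  define n where "n = (cmod c)\<^sup>2"
  have a: "a \<noteq> 0" using c by (simp add: a_def)
  have n: "n = a\<^sup>2 + b\<^sup>2" by (simp add: n_def a_def b_def cmod_power2)
  have npos: "n > 0" using a n by (simp add: sum_power2_gt_zero_iff)
  have "(\<integral>\<^sup>+z. g (c * z) \<partial>lborel)
      = (\<integral>\<^sup>+x. \<integral>\<^sup>+y. g (Complex (a * x - b * y) (a * y + b * x)) \<partial>lborel \<partial>lborel)"
    by (subst nn_integral_lborel_complex) (auto simp: complex_mult a_def b_def complex_eq_iff intro!: nn_integral_cong arg_cong[of _ _ g])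
  also have "\<dots> = (\<integral>\<^sup>+x. ennreal \<bar>1/a\<bar> * (\<integral>\<^sup>+y. g (Complex ((n/a) * x - b/a * y) y) \<partial>lborel) \<partial>lborel)"
  proof (rule nn_integral_cong)
    fix x :: real
    have "(\<integral>\<^sup>+y. g (Complex (a * x - b * y) (a * y + b * x)) \<partial>lborel)
       = ennreal \<bar>1/a\<bar> * (\<integral>\<^sup>+y. g (Complex (a * x - b * (- (b*x)/a + 1/a * y)) (a * (- (b*x)/a + 1/a * y) + b * x)) \<partial>lborel)"
      using a by (subst nn_integral_real_affine[where c="1/a" and t="-(b*x)/a"]) auto
    also have "\<dots> = ennreal \<bar>1/a\<bar> * (\<integral>\<^sup>+y. g (Complex ((n/a) * x - b/a * y) y) \<partial>lborel)"
    proof -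
      have "Complex (a * x - b * (- (b*x)/a + 1/a * y)) (a * (- (b*x)/a + 1/a * y) + b * x) = Complex ((n/a) * x - b/a * y) y" for y
        using a by (auto simp: complex_eq_iff n field_simps power2_eq_square)
      then show ?thesis by simp
    qed
    finally show "(\<integral>\<^sup>+y. g (Complex (a * x - b * y) (a * y + b * x)) \<partial>lborel) = ennreal \<bar>1/a\<bar> * (\<integral>\<^sup>+y. g (Complex ((n/a) * x - b/a * y) y) \<partial>lborel)" .
  qed
  also have "\<dots> = ennreal \<bar>1/a\<bar> * (\<integral>\<^sup>+x. \<integral>\<^sup>+y. g (Complex ((n/a) * x - b/a * y) y) \<partial>lborel \<partial>lborel)"
    by (rule nn_integral_cmult) measurable
  also have "(\<integral>\<^sup>+x. \<integral>\<^sup>+y. g (Complex ((n/a) * x - b/a * y) y) \<partial>lborel \<partial>lborel)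
           = (\<integral>\<^sup>+y. \<integral>\<^sup>+x. g (Complex ((n/a) * x - b/a * y) y) \<partial>lborel \<partial>lborel)"
    by (rule lborel_pair.Fubini') measurable
  also have "\<dots> = (\<integral>\<^sup>+y. ennreal \<bar>a/n\<bar> * (\<integral>\<^sup>+x. g (Complex x y) \<partial>lborel) \<partial>lborel)"
  proof (rule nn_integral_cong)
    fix y :: real
    have "(\<integral>\<^sup>+x. g (Complex x y) \<partial>lborel) = ennreal \<bar>n/a\<bar> * (\<integral>\<^sup>+x. g (Complex (-(b/a*y) + n/a * x) y) \<partial>lborel)"
      using a npos by (subst nn_integral_real_affine[where c="n/a" and t="-(b/a*y)"]) auto
    then have "ennreal \<bar>a/n\<bar> * (\<integral>\<^sup>+x. g (Complex x y) \<partial>lborel) = (ennreal \<bar>a/n\<bar> * ennreal \<bar>n/a\<bar>) * (\<integral>\<^sup>+x. g (Complex (-(b/a*y) + n/a * x) y) \<partial>lborel)"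
      by (simp add: mult.assoc)
    also have "ennreal \<bar>a/n\<bar> * ennreal \<bar>n/a\<bar> = 1"
      using a npos by (simp flip: ennreal_mult abs_mult)
    finally show "(\<integral>\<^sup>+x. g (Complex ((n/a) * x - b/a * y) y) \<partial>lborel) = ennreal \<bar>a/n\<bar> * (\<integral>\<^sup>+x. g (Complex x y) \<partial>lborel)"
      by (simp add: algebra_simps)
  qed
  also have "\<dots> = ennreal \<bar>a/n\<bar> * (\<integral>\<^sup>+y. \<integral>\<^sup>+x. g (Complex x y) \<partial>lborel \<partial>lborel)"
    by (rule nn_integral_cmult) measurable
  also have "(\<integral>\<^sup>+y. \<integral>\<^sup>+x. g (Complex x y) \<partial>lborel \<partial>lborel) = (\<integral>\<^sup>+x. \<integral>\<^sup>+y. g (Complex x y) \<partial>lborel \<partial>lborel)"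
    by (rule lborel_pair.Fubini') measurable
  also have "\<dots> = (\<integral>\<^sup>+z. g z \<partial>lborel)"
    by (rule nn_integral_lborel_complex[symmetric]) measurable
  finally have "ennreal n * (\<integral>\<^sup>+z. g (c * z) \<partial>lborel) = (ennreal n * (ennreal \<bar>1/a\<bar> * ennreal \<bar>a/n\<bar>)) * (\<integral>\<^sup>+z. g z \<partial>lborel)"
    by (simp add: mult.assoc)
  also have "ennreal n * (ennreal \<bar>1/a\<bar> * ennreal \<bar>a/n\<bar>) = 1"
    using a npos by (simp flip: ennreal_mult abs_mult)
  finally show ?thesis by (simp add: n_def)
qed

lemma nn_integral_complex_mult:
  fixes g :: "complex \<Rightarrow> ennreal"
  assumes [measurable]: "g \<in> borel_measurable borel" and c: "c \<noteq> 0"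
  shows "(\<integral>\<^sup>+z. g z \<partial>lborel) = ennreal ((cmod c)\<^sup>2) * (\<integral>\<^sup>+z. g (c * z) \<partial>lborel)"
proof (cases "Re c = 0")
  case False
  then show ?thesis by (rule nn_integral_complex_mult_aux[OF assms(1)])
next
  case True
  \<comment> \<open>A purely imaginary factor is the product of two factors with nonzero real part.\<close>
  define d where "d = 1 + \<i>"
  define e where "e = c / d"
  have "Re d \<noteq> 0" by (simp add: d_def)
  have "Re (c / d) \<noteq> 0" using True c by (auto simp: d_def Re_divide complex_eq_iff)
  then have e: "Re e \<noteq> 0" by (simp add: e_def)
  have d0: "d \<noteq> 0" using \<open>Re d \<noteq> 0\<close> by auto
  have "(\<integral>\<^sup>+z. g z \<partial>lborel) = ennreal ((cmod d)\<^sup>2) * (\<integral>\<^sup>+z. g (d * z) \<partial>lborel)"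
    using \<open>Re d \<noteq> 0\<close> by (intro nn_integral_complex_mult_aux) auto
  also have "(\<integral>\<^sup>+z. g (d * z) \<partial>lborel) = ennreal ((cmod e)\<^sup>2) * (\<integral>\<^sup>+z. g (d * (e * z)) \<partial>lborel)"
    using e by (intro nn_integral_complex_mult_aux[where g="\<lambda>z. g (d * z)"]) auto
  also have "(\<lambda>z. g (d * (e * z))) = (\<lambda>z. g (c * z))"
    using d0 by (auto simp: e_def fun_eq_iff)
  finally have "(\<integral>\<^sup>+z. g z \<partial>lborel) = (ennreal ((cmod d)\<^sup>2) * ennreal ((cmod e)\<^sup>2)) * (\<integral>\<^sup>+z. g (c * z) \<partial>lborel)"
    by (simp add: mult.assoc)
  also have "ennreal ((cmod d)\<^sup>2) * ennreal ((cmod e)\<^sup>2) = ennreal ((cmod c)\<^sup>2)"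
    using d0 by (simp add: e_def norm_divide power_divide flip: ennreal_mult)
  finally show ?thesis .
qed

definition vec2 :: "complex \<Rightarrow> complex \<Rightarrow> complex^2" where
  "vec2 z w = (\<chi> i. if i = 1 then z else w)"

lemma vec2_nth [simp]: "vec2 z w $ 1 = z" "vec2 z w $ 2 = w"
  by (simp_all add: vec2_def)

lemma vec2_eta: "vec2 (p $ 1) (p $ 2) = p"
  by (simp add: vec_eq_iff forall_2)

lemma continuous_on_vec2 [continuous_intros]:
  assumes "continuous_on S f" "continuous_on S g"
  shows "continuous_on S (\<lambda>x. vec2 (f x) (g x))"
proof -
  have "continuous_on S (\<lambda>x. if i = 1 then f x else g x)" for i :: 2
    using assms by (cases "i = 1") auto
  then have "continuous_on S (\<lambda>x. (\<chi> i. if i = 1 then f x else g x) :: complex^2)"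
    by (rule continuous_on_vec_lambda)
  then show ?thesis by (simp add: vec2_def)
qed

lemma measurable_vec2 [measurable]:
  assumes [measurable]: "f \<in> borel_measurable M" "g \<in> borel_measurable M"
  shows "(\<lambda>x. vec2 (f x) (g x)) \<in> borel_measurable M"
proof -
  have "(\<lambda>p. vec2 (fst p) (snd p)) \<in> borel_measurable borel"
    by (rule borel_measurable_continuous_onI) (intro continuous_intros)
  then have [measurable]: "(\<lambda>p. vec2 (fst p) (snd p)) \<in> borel_measurable (borel \<Otimes>\<^sub>M borel)"
    by (simp add: borel_prod)
  have "(\<lambda>x. (\<lambda>p. vec2 (fst p) (snd p)) (f x, g x)) \<in> borel_measurable M"
    by measurable
  then show ?thesis by simp
qed

lemma lborel_vec2_eq: "(lborel :: (complex^2) measure) = distr (lborel \<Otimes>\<^sub>M lborel) borel (\<lambda>(z, w). vec2 z w)"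
proof (rule lborel_eqI)
  fix l u :: "complex^2"
  assume le: "\<And>b. b \<in> Basis \<Longrightarrow> l \<bullet> b \<le> u \<bullet> b"
  have le': "b \<in> Basis \<Longrightarrow> l $ i \<bullet> b \<le> u $ i \<bullet> b" for i b
    using le[of "axis i b"] by (auto simp: inner_axis axis_in_Basis_iff)
  have *: "(\<lambda>(z, w). vec2 z w) -` box l u \<inter> space (lborel \<Otimes>\<^sub>M lborel) = box (l $ 1) (u $ 1) \<times> box (l $ 2) (u $ 2)"
    by (auto simp: mem_box Basis_vec_def inner_axis space_pair_measure forall_2)
  have B: "(Basis :: (complex^2) set) = (\<lambda>b. axis 1 b) ` Basis \<union> (\<lambda>b. axis 2 b) ` Basis"
    by (auto simp: Basis_vec_def UNIV_2)
  have disj: "(\<lambda>b. axis (1::2) b) ` (Basis :: complex set) \<inter> (\<lambda>b. axis 2 b) ` Basis = {}"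
    by (auto simp: axis_eq_axis)
  have p: "(\<Prod>b\<in>(Basis :: (complex^2) set). (u - l) \<bullet> b) = (\<Prod>b\<in>Basis. (u $ 1 - l $ 1) \<bullet> b) * (\<Prod>b\<in>Basis. (u $ 2 - l $ 2) \<bullet> b)"
    unfolding B by (subst prod.union_disjoint)
      (use disj in \<open>auto simp: prod.reindex inj_on_def axis_eq_axis inner_axis\<close>)
  have nn: "0 \<le> (\<Prod>b\<in>Basis. (u $ i - l $ i) \<bullet> b)" for i
    using le' by (intro prod_nonneg) (auto simp: inner_diff_left)
  have m: "(\<lambda>(z, w). vec2 z w) \<in> lborel \<Otimes>\<^sub>M lborel \<rightarrow>\<^sub>M borel" by measurable
  show "emeasure (distr (lborel \<Otimes>\<^sub>M lborel) borel (\<lambda>(z, w). vec2 z w)) (box l u) = (\<Prod>b\<in>Basis. (u - l) \<bullet> b)"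
    unfolding emeasure_distr[OF m, simplified] using le' nn
    by (simp add: * emeasure_distr[OF m] lborel.emeasure_pair_measure_Times emeasure_lborel_box p ennreal_mult del: vec2_nth)
qed simp

lemma nn_integral_lborel_vec2:
  fixes g :: "complex^2 \<Rightarrow> ennreal"
  assumes [measurable]: "g \<in> borel_measurable borel"
  shows "(\<integral>\<^sup>+p. g p \<partial>lborel) = (\<integral>\<^sup>+z. \<integral>\<^sup>+w. g (vec2 z w) \<partial>lborel \<partial>lborel)"
  by (subst lborel_vec2_eq, subst nn_integral_distr, simp, simp, subst lborel.nn_integral_fst[symmetric])
    (simp_all add: case_prod_unfold)

text \<open>The torus invariance of Lebesgue measure gives both the rotation invariance of norms and, for the factors
  \<open>\<plusminus> 1\<close>, the orthogonality of the coordinate functions.\<close>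

lemma lborel_distr_torus:
  assumes "cmod a = 1" "cmod b = 1"
  shows "distr lborel borel (\<lambda>p::complex^2. vec2 (a * p $ 1) (b * p $ 2)) = lborel"
proof (rule measure_eqI)
  have [measurable]: "(\<lambda>p::complex^2. p $ i) \<in> borel_measurable borel" for i
    by (rule borel_measurable_continuous_onI) (intro continuous_intros)
  fix A assume "A \<in> sets (distr lborel borel (\<lambda>p::complex^2. vec2 (a * p $ 1) (b * p $ 2)))"
  then have [measurable]: "A \<in> sets borel" by simp
  have nz: "a \<noteq> 0" "b \<noteq> 0" using assms by auto
  have "emeasure (distr lborel borel (\<lambda>p::complex^2. vec2 (a * p $ 1) (b * p $ 2))) A
     = (\<integral>\<^sup>+p. indicator A p \<partial>(distr lborel borel (\<lambda>p::complex^2. vec2 (a * p $ 1) (b * p $ 2))))"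
    by simp
  also have "\<dots> = (\<integral>\<^sup>+p. indicator A (vec2 (a * p $ 1) (b * p $ 2)) \<partial>(lborel :: (complex^2) measure))"
    by (rule nn_integral_distr) measurable
  also have "\<dots> = (\<integral>\<^sup>+z. \<integral>\<^sup>+w. indicator A (vec2 (a * z) (b * w)) \<partial>lborel \<partial>lborel)"
    by (subst nn_integral_lborel_vec2) auto
  also have "\<dots> = (\<integral>\<^sup>+z. \<integral>\<^sup>+w. indicator A (vec2 (a * z) w) \<partial>lborel \<partial>lborel)"
    using assms nz 
    by (intro nn_integral_cong nn_integral_complex_mult[where c=b and g="\<lambda>w. indicator A (vec2 (a * _) w)", THEN trans, symmetric]) auto
  also have "\<dots> = (\<integral>\<^sup>+z. \<integral>\<^sup>+w. indicator A (vec2 z w) \<partial>lborel \<partial>lborel)"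
    using assms nz 
    by (intro nn_integral_complex_mult[where c=a and g="\<lambda>z. \<integral>\<^sup>+w. indicator A (vec2 z w) \<partial>lborel", THEN trans, symmetric]) auto
  also have "\<dots> = (\<integral>\<^sup>+p. indicator A p \<partial>lborel)"
    by (subst nn_integral_lborel_vec2) auto
  finally show "emeasure (distr lborel borel (\<lambda>p::complex^2. vec2 (a * p $ 1) (b * p $ 2))) A = emeasure lborel A"
    by simp
qed simp

section \<open>Homogeneous expansion on balanced domains\<close>

definition balanced :: "(complex^'n) set \<Rightarrow> bool" where
  "balanced D \<longleftrightarrow> (\<forall>p\<in>D. \<forall>c. cmod c \<le> 1 \<longrightarrow> c *s p \<in> D)"

lemma continuous_on_vector_smult [continuous_intros]:
  fixes g :: "'a::topological_space \<Rightarrow> complex^'n"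
  assumes "continuous_on S f" "continuous_on S g"
  shows "continuous_on S (\<lambda>x. f x *s g x)"
  unfolding vector_scalar_mult_def using assms by (intro continuous_intros)

lemma holomorphic_vec_on_imp_continuous_on:
  "holomorphic_vec_on f D \<Longrightarrow> continuous_on D f"
  unfolding holomorphic_vec_on_def
  by (meson continuous_on_eq_continuous_within has_derivative_continuous)

lemma has_derivative_vector_smult_left:
  fixes v :: "complex^'n"
  shows "((\<lambda>l. l *s v) has_derivative (\<lambda>h. h *s v)) (at x)"
proof -
  have "linear (\<lambda>h. h *s v)"
    by (rule linearI) (auto simp: vec_eq_iff algebra_simps)
  then show ?thesis
    by (simp add: linear_conv_bounded_linear bounded_linear_imp_has_derivative)
qed

lemma open_slice:
  fixes D :: "(complex^'n) set"
  assumes "open D"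
  shows "open {l. q + l *s v \<in> D}"
proof -
  have "continuous_on UNIV (\<lambda>l. q + l *s v)" by (intro continuous_intros)
  then show ?thesis using assms by (auto dest: open_vimage simp: vimage_def)
qed

lemma slice_has_field_derivative:
  fixes v :: "complex^'n"
  assumes f': "(f has_derivative f') (at (q + l *s v))" and lin: "\<And>c v. f' (c *s v) = c * f' v"
  shows "((\<lambda>l. f (q + l *s v)) has_field_derivative f' v) (at l)"
proof -
  have "((\<lambda>l. q + l *s v) has_derivative (\<lambda>h. h *s v)) (at l)"
    by (rule has_derivative_eq_rhs[OF has_derivative_add[OF has_derivative_const has_derivative_vector_smult_left]]) simp
  from has_derivative_compose[OF this f']
  show ?thesis by (simp add: lin has_field_derivative_def mult_commute_abs)
qed

lemma holomorphic_slice: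
  fixes D :: "(complex^'n) set"
  assumes D: "open D" and f: "holomorphic_vec_on f D"
  shows "(\<lambda>l. f (q + l *s v)) holomorphic_on {l. q + l *s v \<in> D}"
proof (rule holomorphic_onI)
  fix l assume "l \<in> {l. q + l *s v \<in> D}"
  then have "q + l *s v \<in> D" by simp
  then obtain f' where "(f has_derivative f') (at (q + l *s v))" "\<And>c v. f' (c *s v) = c * f' v"
    using f D unfolding holomorphic_vec_on_def by (metis at_within_open)
  then have "((\<lambda>l. f (q + l *s v)) has_field_derivative f' v) (at l)"
    by (rule slice_has_field_derivative)
  then show "(\<lambda>l. f (q + l *s v)) field_differentiable at l within {l. q + l *s v \<in> D}"
    using field_differentiable_at_within field_differentiable_def by blast
qed

text \<open>The \<open>m\<close>-th Fourier coefficient of \<open>f\<close> along the circle through \<open>p\<close>, with the circle parametrized by \<open>{0..1}\<close> so that no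
  normalizing factor is needed. On a balanced domain it is the homogeneous part of degree \<open>m\<close> of \<open>f\<close>.\<close>

definition homog_part :: "nat \<Rightarrow> (complex^'n \<Rightarrow> complex) \<Rightarrow> complex^'n \<Rightarrow> complex" where
  "homog_part m f p = integral {0..1} (\<lambda>t. f (cis (2*pi*t) *s p) * cis (- (2*pi*real m*t)))"

lemma balancedD: "balanced D \<Longrightarrow> p \<in> D \<Longrightarrow> cmod c \<le> 1 \<Longrightarrow> c *s p \<in> D"
  by (auto simp: balanced_def)

lemma open_ray:
  fixes D :: "(complex^'n) set"
  shows "open D \<Longrightarrow> open {l. l *s p \<in> D}"
  using open_slice[of D 0 p] by simp

text \<open>By openness a slightly larger multiple of \<open>p\<close> still lies in \<open>D\<close>, and balancedness then yields a whole disc of multiples.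
  The radius exceeds 1, so Cauchy's formula applies on the unit circle.\<close>

lemma ray_ball:
  fixes D :: "(complex^'n) set"
  assumes D: "open D" and bal: "balanced D" and p: "p \<in> D"
  obtains r where "r > 1" "ball 0 r \<subseteq> {l. l *s p \<in> D}"
proof -
  have "1 \<in> {l. l *s p \<in> D}" using p by simp
  then obtain e where e: "e > 0" "cball 1 e \<subseteq> {l. l *s p \<in> D}"
    using open_ray[OF D] open_contains_cball by blast
  let ?c = "complex_of_real (1 + e)"
  have "?c \<in> cball 1 e"
    using e by (simp add: dist_norm)
  then have c: "?c *s p \<in> D"
    using e by blast
  have "l *s p \<in> D" if "cmod l < 1 + e" for l
  proof -
    have nz: "?c \<noteq> 0" using e by (simp only: of_real_eq_0_iff)
    have nc: "cmod ?c = 1 + e" using e by (simp only: norm_of_real)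
    have "cmod (l / ?c) \<le> 1" using that e unfolding norm_divide nc by simp
    from balancedD[OF bal c this] show ?thesis
      using nz by (simp only: vector_smult_assoc times_divide_eq_left nonzero_mult_div_cancel_right not_False_eq_True)
  qed
  then show thesis using e by (intro that[of "1 + e"]) auto
qed

context
  fixes D :: "(complex^'n) set" and f :: "complex^'n \<Rightarrow> complex"
  assumes D: "open D" and bal: "balanced D" and f: "holomorphic_vec_on f D"
begin

lemma holomorphic_ray: "(\<lambda>l. f (l *s p)) holomorphic_on {l. l *s p \<in> D}"
  using holomorphic_slice[OF D f, of 0 p] by simp

text \<open>Cauchy's integral formula for derivatives, on the unit circle.\<close>

lemma homog_part_eq_deriv:
  assumes p: "p \<in> D"
  shows "homog_part m f p = (deriv ^^ m) (\<lambda>l. f (l *s p)) 0 / fact m"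
proof -
  let ?F = "\<lambda>l. f (l *s p)"
  obtain r where r: "r > 1" "ball 0 r \<subseteq> {l. l *s p \<in> D}" using ray_ball[OF D bal p] .
  have hol: "?F holomorphic_on ball 0 r"
    using holomorphic_ray r holomorphic_on_subset by blast
  have sub: "cball 0 1 \<subseteq> ball (0::complex) r" using r by auto
  have "((\<lambda>u. ?F u / (u - 0) ^ Suc m) has_contour_integral (2 * pi * \<i> / fact m * (deriv ^^ m) ?F 0)) (circlepath 0 1)"
    using sub by (intro Cauchy_has_contour_integral_higher_derivative_circlepath
        holomorphic_on_imp_continuous_on holomorphic_on_subset[OF hol]) auto
  then have "((\<lambda>t. ?F (circlepath 0 1 t) / circlepath 0 1 t ^ Suc m * vector_derivative (circlepath 0 1) (at t))
      has_integral (2 * pi * \<i> / fact m * (deriv ^^ m) ?F 0)) {0..1}"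
    by (simp add: has_contour_integral)
  then have "((\<lambda>t. ?F (cis (2*pi*t)) * cis (- (2*pi*real m*t)) * (2 * pi * \<i>))
      has_integral (2 * pi * \<i> / fact m * (deriv ^^ m) ?F 0)) {0..1}"
  proof (rule has_integral_eq[rotated])
    fix t :: real
    have c: "circlepath 0 1 t = cis (2*pi*t)"
      by (simp add: circlepath cis_conv_exp mult_ac)
    have v: "vector_derivative (circlepath 0 1) (at t) = 2 * pi * \<i> * cis (2*pi*t)"
      by (simp add: vector_derivative_circlepath cis_conv_exp mult_ac)
    have "cis (2*pi*t) ^ m = cis (2*pi*real m*t)"
      unfolding Complex.DeMoivre by (simp add: mult_ac)
    then have "cis (- (2*pi*real m*t)) = 1 / cis (2*pi*t) ^ m"
      by (simp add: divide_inverse)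
    then show "?F (circlepath 0 1 t) / circlepath 0 1 t ^ Suc m * vector_derivative (circlepath 0 1) (at t)
       = ?F (cis (2*pi*t)) * cis (- (2*pi*real m*t)) * (2 * pi * \<i>)"
      unfolding c v by (simp add: field_simps)
  qed
  then have "((\<lambda>t. ?F (cis (2*pi*t)) * cis (- (2*pi*real m*t)))
      has_integral ((2 * pi * \<i> / fact m * (deriv ^^ m) ?F 0) * (1 / (2 * pi * \<i>)))) {0..1}"
    by (drule_tac has_integral_mult_left[where c="1/(2*pi*\<i>)"]) simp
  then show ?thesis
    unfolding homog_part_def by (auto dest!: integral_unique)
qed

lemma homog_part_smult:
  assumes p: "p \<in> D" and c: "c *s p \<in> D"
  shows "homog_part m f (c *s p) = c ^ m * homog_part m f p"
proof -
  have "(deriv ^^ m) (\<lambda>l. f ((c * l) *s p)) 0 = c ^ m * (deriv ^^ m) (\<lambda>l. f (l *s p)) (c * 0)"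
  proof (rule higher_deriv_compose_linear[where f="\<lambda>l. f (l *s p)"])
    show "(\<lambda>l. f (l *s p)) holomorphic_on {l. l *s p \<in> D}" by (rule holomorphic_ray)
    show "open {l. l *s (c *s p) \<in> D}" "open {l. l *s p \<in> D}" by (rule open_ray[OF D])+
    show "0 \<in> {l. l *s (c *s p) \<in> D}" using balancedD[OF bal c, of 0] by simp
    show "c * w \<in> {l. l *s p \<in> D}" if "w \<in> {l. l *s (c *s p) \<in> D}" for w
      using that by (simp add: vector_smult_assoc mult.commute)
  qed
  then show ?thesis
    using p c by (simp add: homog_part_eq_deriv vector_smult_assoc mult.commute)
qed

lemma continuous_on_homog_integrand:
  "continuous_on (D \<times> UNIV) (\<lambda>(p, t). f (cis (2*pi*t) *s p) * cis (- (2*pi*real m*t)))"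
proof -
  have "continuous_on (D \<times> UNIV) (\<lambda>x. f (cis (2 * pi * snd x) *s fst x))"
    by (rule continuous_on_compose2[OF holomorphic_vec_on_imp_continuous_on[OF f]])
      (auto intro!: continuous_intros balancedD[OF bal])
  then show ?thesis
    unfolding case_prod_unfold by (intro continuous_intros)
qed

lemma continuous_on_homog_part: "continuous_on D (homog_part m f)"
proof -
  have "continuous_on D (\<lambda>p. integral (cbox 0 1) (\<lambda>t. f (cis (2*pi*t) *s p) * cis (- (2*pi*real m*t))))"
    by (rule integral_continuous_on_param[OF continuous_on_subset[OF continuous_on_homog_integrand]]) auto
  then show ?thesis by (simp add: homog_part_def[abs_def])
qed

text \<open>The Cauchy-Schwarz inequality against a constant: the variance of the integrand around its mean is nonnegative.\<close>

lemma homog_part_norm_le: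
  assumes p: "p \<in> D"
  shows "(cmod (homog_part m f p))\<^sup>2 \<le> integral {0..1} (\<lambda>t. (cmod (f (cis (2*pi*t) *s p)))\<^sup>2)"
proof -
  define g where "g = (\<lambda>t. f (cis (2*pi*t) *s p) * cis (- (2*pi*real m*t)))"
  define c where "c = homog_part m f p"
  have contg: "continuous_on {0..1} g"
  proof -
    have "continuous_on {0..1} (\<lambda>t. (p, t))" by (intro continuous_intros)
    from continuous_on_compose2[OF continuous_on_homog_integrand[of m] this] p
    show ?thesis by (auto simp: g_def)
  qed
  have intg: "(g has_integral c) {0..1}"
    unfolding c_def homog_part_def g_def[symmetric]
    by (rule integrable_integral) (rule integrable_continuous_interval[OF contg])
  have sq: "(cmod (g t - c))\<^sup>2 = (cmod (g t))\<^sup>2 - 2 * Re (cnj c * g t) + (cmod c)\<^sup>2" for t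
    unfolding cmod_power2 by (simp add: power2_eq_square algebra_simps)
  have i1: "((\<lambda>t. (cmod (g t))\<^sup>2) has_integral (integral {0..1} (\<lambda>t. (cmod (g t))\<^sup>2))) {0..1}"
    by (intro integrable_integral integrable_continuous_interval continuous_intros contg)
  have i2: "((\<lambda>t. Re (cnj c * g t)) has_integral Re (cnj c * c)) {0..1}"
    by (intro has_integral_Re has_integral_mult_right intg)
  have i3: "((\<lambda>t::real. (cmod c)\<^sup>2) has_integral (cmod c)\<^sup>2) {0..1}"
    using has_integral_const_real[of "(cmod c)\<^sup>2" 0 1] by simp
  have "((\<lambda>t. (cmod (g t - c))\<^sup>2) has_integral
      (integral {0..1} (\<lambda>t. (cmod (g t))\<^sup>2) - 2 * Re (cnj c * c) + (cmod c)\<^sup>2)) {0..1}"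
    unfolding sq by (intro has_integral_add has_integral_diff has_integral_mult_right i1 i2 i3)
  then have "0 \<le> integral {0..1} (\<lambda>t. (cmod (g t))\<^sup>2) - 2 * Re (cnj c * c) + (cmod c)\<^sup>2"
    by (rule has_integral_nonneg) auto
  moreover have "Re (cnj c * c) = (cmod c)\<^sup>2"
    unfolding cmod_power2 by (simp add: power2_eq_square)
  ultimately show ?thesis
    by (simp add: c_def g_def norm_mult)
qed

text \<open>The Taylor series of \<open>\<lambda> \<mapsto> f (\<lambda> p)\<close> converges at \<open>\<lambda> = 1\<close>, and only its terms of degree 0 and 1 remain.\<close>

lemma eq_affine_if_homog_parts_vanish:
  assumes p: "p \<in> D" and 0: "\<And>m. m \<ge> 2 \<Longrightarrow> homog_part m f p = 0"
    and f': "(f has_derivative f') (at 0)" "\<And>c v. f' (c *s v) = c * f' v"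
  shows "f p = f 0 + f' p"
proof -
  let ?F = "\<lambda>l. f (l *s p)"
  obtain r where r: "r > 1" "ball 0 r \<subseteq> {l. l *s p \<in> D}" using ray_ball[OF D bal p] .
  have hol: "?F holomorphic_on ball 0 r"
    using holomorphic_ray r holomorphic_on_subset by blast
  have s: "(\<lambda>n. (deriv ^^ n) ?F 0 / fact n * (1 - 0) ^ n) sums ?F 1"
    using r by (intro holomorphic_power_series[OF hol]) auto
  have z: "(deriv ^^ n) ?F 0 = 0" if "n \<ge> 2" for n
    using 0[OF that] homog_part_eq_deriv[OF p, of n] by simp
  have "(\<lambda>n. (deriv ^^ n) ?F 0 / fact n * (1 - 0) ^ n) sums (\<Sum>n<2. (deriv ^^ n) ?F 0 / fact n * (1 - 0) ^ n)"
    by (rule sums_finite) (auto simp: z)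
  with s have "?F 1 = (\<Sum>n<2. (deriv ^^ n) ?F 0 / fact n * (1 - 0) ^ n)"
    by (rule sums_unique2)
  moreover have "deriv ?F 0 = f' p"
    using slice_has_field_derivative[of f f' 0 0 p] f' by (intro DERIV_imp_deriv) auto
  ultimately show ?thesis by (simp add: numeral_2_eq_2)
qed

end

lemma vec2_smult: "c *s vec2 z w = vec2 (c * z) (c * w)"
  by (simp add: vec_eq_iff forall_2)

lemma borel_measurable_vec_nth_complex [measurable]: "(\<lambda>p::complex^'n. p $ i) \<in> borel_measurable borel"
  by (rule borel_measurable_continuous_onI) (intro continuous_intros)

lemma nn_integral_rotate:
  fixes g :: "complex^2 \<Rightarrow> ennreal"
  assumes [measurable]: "g \<in> borel_measurable borel" and c: "cmod c = 1"
  shows "(\<integral>\<^sup>+p. g (c *s p) \<partial>lborel) = (\<integral>\<^sup>+p. g p \<partial>lborel)"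
proof -
  have [measurable]: "(*s) c \<in> borel_measurable (borel :: (complex^2) measure)"
    by (rule borel_measurable_continuous_onI) (intro continuous_intros)
  have "(\<integral>\<^sup>+p. g p \<partial>lborel) = (\<integral>\<^sup>+p. g p \<partial>(distr lborel borel (\<lambda>p::complex^2. vec2 (c * p $ 1) (c * p $ 2))))"
    by (simp only: lborel_distr_torus[OF c c])
  also have "\<dots> = (\<integral>\<^sup>+p. g (c *s p) \<partial>lborel)"
    by (subst nn_integral_distr) (simp_all add: vec2_smult[symmetric] vec2_eta)
  finally show ?thesis ..
qed

text \<open>Integrate the pointwise bound over \<open>D\<close> and exchange the integrals: for each rotation the inner integral is the
  same as for \<open>f\<close> itself.\<close>

lemma homog_part_L2_le:
  fixes D :: "(complex^2) set"
  assumes D: "open D" and bal: "balanced D" and f: "holomorphic_vec_on f D"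
  shows "(\<integral>\<^sup>+p. ennreal ((cmod (homog_part m f p))\<^sup>2) * indicator D p \<partial>lborel)
       \<le> (\<integral>\<^sup>+p. ennreal ((cmod (f p))\<^sup>2) * indicator D p \<partial>lborel)"
proof -
  define G where "G = (\<lambda>p. ennreal ((cmod (f p))\<^sup>2) * indicator D p)"
  have [measurable]: "D \<in> sets borel" using D by auto
  have "(\<lambda>p. indicator D p *\<^sub>R f p) \<in> borel_measurable borel"
    by (rule borel_measurable_continuous_on_indicator[OF _ holomorphic_vec_on_imp_continuous_on[OF f]]) simp
  then have "(\<lambda>p. ennreal ((cmod (indicator D p *\<^sub>R f p))\<^sup>2)) \<in> borel_measurable borel"
    by measurable
  also have "(\<lambda>p. ennreal ((cmod (indicator D p *\<^sub>R f p))\<^sup>2)) = G"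
    by (auto simp: G_def fun_eq_iff indicator_def)
  finally have G[measurable]: "G \<in> borel_measurable borel" .
  define rot :: "real \<Rightarrow> complex^2 \<Rightarrow> complex^2" where "rot t p = cis (2 * pi * t) *s p" for t p
  have "(\<lambda>x. rot (snd x) (fst x)) \<in> borel_measurable borel"
    unfolding rot_def by (rule borel_measurable_continuous_onI) (intro continuous_intros)
  then have [measurable]: "(\<lambda>x. rot (snd x) (fst x)) \<in> borel_measurable (borel \<Otimes>\<^sub>M borel)"
    by (simp add: borel_prod)
  have pw: "ennreal ((cmod (homog_part m f p))\<^sup>2) * indicator D p
      \<le> (\<integral>\<^sup>+t. indicator {0..1} t * G (rot t p) \<partial>lborel)" for p
  proof (cases "p \<in> D")
    case True
    define \<phi> where "\<phi> = (\<lambda>t. (cmod (f (cis (2*pi*t) *s p)))\<^sup>2)"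
    have inD: "cis (2*pi*t) *s p \<in> D" for t
      using balancedD[OF bal True] by simp
    have cont: "continuous_on UNIV \<phi>"
      unfolding \<phi>_def
      by (intro continuous_intros continuous_on_compose2[OF holomorphic_vec_on_imp_continuous_on[OF f]])
        (auto simp: inD)
    then have [measurable]: "\<phi> \<in> borel_measurable borel"
      by (rule borel_measurable_continuous_onI)
    have "(\<phi> has_integral integral {0..1} \<phi>) {0..1}"
      by (intro integrable_integral integrable_continuous_interval continuous_on_subset[OF cont]) auto
    then have "((\<lambda>t. indicator {0..1} t * \<phi> t) has_integral integral {0..1} \<phi>) UNIV"
      by (subst (asm) has_integral_restrict_UNIV[symmetric])
        (auto elim!: has_integral_eq[rotated] simp: indicator_def)
    moreover have "(\<lambda>t. indicator {0..1} t * \<phi> t) \<in> borel_measurable borel" by measurable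
    moreover have "0 \<le> indicator {0..1} t * \<phi> t" for t by (simp add: \<phi>_def)
    ultimately have "(\<integral>\<^sup>+t. ennreal (indicator {0..1} t * \<phi> t) \<partial>lborel) = integral {0..1} \<phi>"
      by (intro nn_integral_has_integral_lborel)
    also have "(\<lambda>t. ennreal (indicator {0..1} t * \<phi> t)) = (\<lambda>t. indicator {0..1} t * G (rot t p))"
      by (auto simp: fun_eq_iff G_def rot_def inD \<phi>_def indicator_def)
    finally have "(\<integral>\<^sup>+t. indicator {0..1} t * G (rot t p) \<partial>lborel) = ennreal (integral {0..1} \<phi>)" .
    then show ?thesis
      using homog_part_norm_le[OF D bal f True, of m] True
      by (simp add: \<phi>_def ennreal_leI)
  qed simp
  have "(\<integral>\<^sup>+p. ennreal ((cmod (homog_part m f p))\<^sup>2) * indicator D p \<partial>lborel)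
      \<le> (\<integral>\<^sup>+p. \<integral>\<^sup>+t. indicator {0..1} t * G (rot t p) \<partial>lborel \<partial>lborel)"
    by (intro nn_integral_mono pw)
  also have "\<dots> = (\<integral>\<^sup>+t. \<integral>\<^sup>+p. indicator {0..1} t * G (rot t p) \<partial>lborel \<partial>lborel)"
    by (rule pair_sigma_finite.Fubini'[OF pair_sigma_finite.intro[OF sigma_finite_lborel sigma_finite_lborel], symmetric])
      (simp add: case_prod_unfold)
  also have "\<dots> = (\<integral>\<^sup>+t. indicator {0..1} (t::real) * (\<integral>\<^sup>+p. G p \<partial>lborel) \<partial>lborel)"
  proof (rule nn_integral_cong)
    fix t :: real
    have [measurable]: "rot t \<in> borel_measurable borel"
      unfolding rot_def[abs_def] by (rule borel_measurable_continuous_onI) (intro continuous_intros)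
    have "(\<lambda>p. G (rot t p)) \<in> borel_measurable lborel" by simp
    then show "(\<integral>\<^sup>+p. indicator {0..1} t * G (rot t p) \<partial>lborel) = indicator {0..1} t * (\<integral>\<^sup>+p. G p \<partial>lborel)"
      by (subst nn_integral_cmult) (auto simp: rot_def nn_integral_rotate)
  qed
  also have "\<dots> = (\<integral>\<^sup>+p. G p \<partial>lborel)"
    by (subst nn_integral_multc) auto
  finally show ?thesis by (simp add: G_def)
qed

section \<open>Geometry of the domain\<close>

lemma r_fun_pos: "0 < r_fun p" and r_fun_ge_1: "1 \<le> r_fun p"
  by (simp_all add: r_fun_def add_pos_nonneg)

lemma open_D_alpha: "open (D_alpha \<alpha>)"
  unfolding D_alpha_def r_fun_def
  by (intro open_Collect_less continuous_intros) (simp_all add: add_nonneg_eq_0_iff add_pos_nonneg less_imp_neq[symmetric])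

lemma diagonal_in_D_alpha: "cmod (p $ 1) = cmod (p $ 2) \<Longrightarrow> p \<in> D_alpha \<alpha>"
  using r_fun_pos[of p] by (simp add: D_alpha_def)

lemma zero_in_D_alpha: "0 \<in> D_alpha \<alpha>"
  by (rule diagonal_in_D_alpha) simp

text \<open>Multiplication by \<open>c\<close> multiplies the left-hand side of the defining inequality by \<open>\<bar>c\<bar>\<^sup>2\<close>, while the right-hand side can only grow.\<close>

lemma balanced_D_alpha:
  assumes \<alpha>: "0 \<le> \<alpha>"
  shows "balanced (D_alpha \<alpha>)"
  unfolding balanced_def
proof (intro ballI allI impI)
  fix p c assume p: "p \<in> D_alpha \<alpha>" and c: "cmod c \<le> 1"
  let ?h = "(cmod (p $ 2))\<^sup>2 - (cmod (p $ 1))\<^sup>2"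
  have c2: "(cmod c)\<^sup>2 \<le> 1" using c by (simp add: power_le_one)
  have "\<bar>(cmod ((c *s p) $ 2))\<^sup>2 - (cmod ((c *s p) $ 1))\<^sup>2\<bar> = (cmod c)\<^sup>2 * \<bar>?h\<bar>"
    by (simp add: norm_mult power_mult_distrib abs_mult flip: right_diff_distrib)
  also have "\<dots> \<le> 1 * \<bar>?h\<bar>" using c2 by (intro mult_right_mono) auto
  also have "\<dots> < r_fun p powr (- \<alpha>)" using p by (simp add: D_alpha_def)
  also have "\<dots> \<le> r_fun (c *s p) powr (- \<alpha>)"
  proof (rule powr_mono2')
    show "r_fun (c *s p) \<le> r_fun p"
      unfolding r_fun_def using c2 by (simp add: norm_mult power_mult_distrib add_mono mult_left_le_one_le)
  qed (use \<alpha> r_fun_pos in auto)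
  finally show "c *s p \<in> D_alpha \<alpha>" by (simp add: D_alpha_def)
qed

lemma powr_le_1_neg: "1 \<le> x \<Longrightarrow> a \<le> 0 \<Longrightarrow> x powr a \<le> (1::real)"
  using powr_mono[of a 0 x] by simp

text \<open>The point is \<open>(z, z u)\<close>; since \<open>\<bar>u\<bar>\<^sup>2 \<le> 2\<close>, the function \<open>r\<close> is at most \<open>4 \<bar>z\<bar>\<^sup>2\<close> there, and the constant 6
  leaves some room.\<close>

lemma thin_annulus_in_D_alpha:
  assumes \<alpha>: "0 \<le> \<alpha>" and z: "1 \<le> cmod z" and u: "\<bar>(cmod u)\<^sup>2 - 1\<bar> < 6 powr (- \<alpha>) * cmod z powr (- 2 - 2 * \<alpha>)"
  shows "vec2 z (z * u) \<in> D_alpha \<alpha>"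
proof -
  have 1: "6 powr (- \<alpha>) * cmod z powr (- 2 - 2 * \<alpha>) \<le> 1 * 1"
    using \<alpha> z by (intro mult_mono powr_le_1_neg) auto
  then have u2: "(cmod u)\<^sup>2 \<le> 2" using u by linarith
  have z1: "1 \<le> (cmod z)\<^sup>2" using z by simp
  have zp: "cmod z > 0" using z by linarith
  have "(cmod z)\<^sup>2 * (cmod u)\<^sup>2 \<le> (cmod z)\<^sup>2 * 2" using u2 by (intro mult_left_mono) auto
  then have r: "r_fun (vec2 z (z * u)) \<le> 6 * (cmod z)\<^sup>2"
    using z1 by (simp add: r_fun_def norm_mult power_mult_distrib)
  have "\<bar>(cmod (z * u))\<^sup>2 - (cmod z)\<^sup>2\<bar> = (cmod z)\<^sup>2 * \<bar>(cmod u)\<^sup>2 - 1\<bar>"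
  proof -
    have "(cmod (z * u))\<^sup>2 - (cmod z)\<^sup>2 = (cmod z)\<^sup>2 * ((cmod u)\<^sup>2 - 1)"
      by (simp add: norm_mult power_mult_distrib algebra_simps)
    then show ?thesis by (simp add: abs_mult)
  qed
  also have "\<dots> < (cmod z)\<^sup>2 * (6 powr (- \<alpha>) * cmod z powr (- 2 - 2 * \<alpha>))"
    using u z1 by (intro mult_strict_left_mono) auto
  also have "\<dots> = 6 powr (- \<alpha>) * (cmod z powr 2 * cmod z powr (- 2 - 2 * \<alpha>))"
    using zp by (simp add: powr_numeral)
  also have "cmod z powr 2 * cmod z powr (- 2 - 2 * \<alpha>) = cmod z powr (2 * (- \<alpha>))"
    by (simp only: powr_add[symmetric]) simp
  also have "\<dots> = ((cmod z)\<^sup>2) powr (- \<alpha>)"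
    using zp by (simp only: powr_powr[symmetric] powr_numeral)
  also have "6 powr (- \<alpha>) * \<dots> = (6 * (cmod z)\<^sup>2) powr (- \<alpha>)"
    by (simp add: powr_mult)
  also have "\<dots> \<le> r_fun (vec2 z (z * u)) powr (- \<alpha>)"
    using r \<alpha> r_fun_pos by (intro powr_mono2') auto
  finally show ?thesis by (simp add: D_alpha_def)
qed

section \<open>Divergence of the norm in degree at least two\<close>

text \<open>After rotation \<open>u0\<close> is \<open>\<i>\<close>, and near \<open>\<i>\<close> the annulus contains a band of vertical width \<open>\<tau>/2\<close> around the graph of
  \<open>x \<mapsto> sqrt (1 - x\<^sup>2)\<close> over an interval of length \<open>\<eta>/2\<close>; its area follows from Fubini's theorem.\<close>

lemma emeasure_thin_annulus_ge:
  fixes u0 :: complex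
  assumes u0: "cmod u0 = 1" and \<eta>: "0 < \<eta>" "\<eta> \<le> 1" and \<tau>: "0 < \<tau>" "\<tau> \<le> \<eta>"
  shows "ennreal (\<eta> * \<tau> / 4) \<le> emeasure lborel {u. dist u0 u < \<eta> \<and> \<bar>(cmod u)\<^sup>2 - 1\<bar> < \<tau>}"
proof -
  define S where "S = {u. dist u0 u < \<eta> \<and> \<bar>(cmod u)\<^sup>2 - 1\<bar> < \<tau>}"
  have "open S" unfolding S_def
    by (intro open_Collect_conj open_Collect_less continuous_intros)
  then have [measurable]: "S \<in> sets borel" by auto
  define c where "c = u0 / \<i>"
  have c: "cmod c = 1" "c \<noteq> 0" "c * \<i> = u0"
  proof -
    show "cmod c = 1" using u0 by (simp add: c_def norm_mult norm_divide)
    then show "c \<noteq> 0" by auto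
    show "c * \<i> = u0" by (metis c_def complex_i_not_zero nonzero_eq_divide_eq)
  qed
  define q where "q = (\<lambda>x::real. sqrt (1 - x\<^sup>2))"
  have [measurable]: "q \<in> borel_measurable borel" by (simp add: q_def)
  have inS: "c * Complex x y \<in> S" if x: "\<bar>x\<bar> < \<eta>/4" and y: "\<bar>y - q x\<bar> < \<tau>/4" for x y
  proof -
    have "\<bar>x\<bar>\<^sup>2 \<le> \<bar>x\<bar>" using x \<eta> power_decreasing[of 1 2 "\<bar>x\<bar>"] by simp
    then have x1: "0 \<le> 1 - x\<^sup>2" "x\<^sup>2 \<le> \<bar>x\<bar>" using x \<eta> by auto
    then have q2: "(q x)\<^sup>2 = 1 - x\<^sup>2" "0 \<le> q x" by (auto simp: q_def)
    have q1: "q x \<le> 1" unfolding q_def by simp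
    have "(1 - \<bar>x\<bar>)\<^sup>2 \<le> 1 - x\<^sup>2" using x1 by (simp add: power2_eq_square algebra_simps)
    then have "1 - \<bar>x\<bar> \<le> q x" unfolding q_def by (rule real_le_rsqrt)
    have "cmod (Complex x y - \<i>) \<le> \<bar>x\<bar> + \<bar>y - 1\<bar>"
      using cmod_le[of "Complex x y - \<i>"] by simp
    also have "\<dots> < \<eta>"
      using x y \<open>1 - \<bar>x\<bar> \<le> q x\<close> q1 \<tau> by linarith
    finally have "cmod (Complex x y - \<i>) < \<eta>" .
    moreover have "dist u0 (c * Complex x y) = cmod (c * (Complex x y - \<i>))"
      by (simp add: dist_norm right_diff_distrib c norm_minus_commute)
    ultimately have d: "dist u0 (c * Complex x y) < \<eta>"
      by (simp add: norm_mult c)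
    have "\<bar>y + q x\<bar> < 9/4" using y q1 q2 \<tau> \<eta> by linarith
    have "(cmod (c * Complex x y))\<^sup>2 = x\<^sup>2 + y\<^sup>2"
      unfolding norm_mult c mult_1 cmod_power2 by simp
    then have "(cmod (c * Complex x y))\<^sup>2 - 1 = (y - q x) * (y + q x)"
      using q2 by (simp add: algebra_simps power2_eq_square)
    then have "\<bar>(cmod (c * Complex x y))\<^sup>2 - 1\<bar> = \<bar>y - q x\<bar> * \<bar>y + q x\<bar>"
      by (simp add: abs_mult)
    also have "\<dots> \<le> (\<tau>/4) * (9/4)"
      using y \<tau> \<open>\<bar>y + q x\<bar> < 9/4\<close> by (intro mult_mono) auto
    also have "\<dots> < \<tau>" using \<tau> by simp
    finally show ?thesis using d by (simp add: S_def)
  qed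
  have "ennreal (\<eta> * \<tau> / 4) = ennreal (\<tau>/2) * ennreal (\<eta>/2)"
    using \<eta> \<tau> by (simp flip: ennreal_mult)
  also have "ennreal (\<eta>/2) = emeasure lborel {-(\<eta>/4)<..<\<eta>/4}"
    using \<eta> by simp
  also have "ennreal (\<tau>/2) * \<dots> = (\<integral>\<^sup>+x. ennreal (\<tau>/2) * indicator {-(\<eta>/4)<..<\<eta>/4} x \<partial>lborel)"
    by (subst nn_integral_cmult_indicator) auto
  also have "\<dots> \<le> (\<integral>\<^sup>+x. \<integral>\<^sup>+y. indicator S (c * Complex x y) \<partial>lborel \<partial>lborel)"
  proof (rule nn_integral_mono)
    fix x :: real
    show "ennreal (\<tau>/2) * indicator {-(\<eta>/4)<..<\<eta>/4} x \<le> (\<integral>\<^sup>+y. indicator S (c * Complex x y) \<partial>lborel)"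
    proof (cases "x \<in> {-(\<eta>/4)<..<\<eta>/4}")
      case True
      then have x: "\<bar>x\<bar> < \<eta>/4" by auto
      have "ennreal (\<tau>/2) = (\<integral>\<^sup>+y. indicator {q x - \<tau>/4<..<q x + \<tau>/4} y \<partial>lborel)"
        using \<tau> by simp
      also have "\<dots> \<le> (\<integral>\<^sup>+y. indicator S (c * Complex x y) \<partial>lborel)"
      proof (rule nn_integral_mono)
        fix y :: real
        show "indicator {q x - \<tau>/4<..<q x + \<tau>/4} y \<le> (indicator S (c * Complex x y) :: ennreal)"
          using inS[OF x, of y, unfolded abs_diff_less_iff] by (simp add: indicator_def)
      qed
      finally show ?thesis using True by simp
    qed simp
  qed
  also have "\<dots> = (\<integral>\<^sup>+v. indicator S (c * v) \<partial>lborel)"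
    by (rule nn_integral_lborel_complex[symmetric]) measurable
  also have "\<dots> = (\<integral>\<^sup>+u. indicator S u \<partial>lborel)"
    using c by (subst nn_integral_complex_mult[of "indicator S" c]) auto
  also have "\<dots> = emeasure lborel S" by simp
  finally show ?thesis by (simp add: S_def)
qed

text \<open>The integral is invariant under scaling by 2, and scaling removes the ring \<open>1 \<le> \<bar>z\<bar> < 2\<close>, which contributes a positive
  amount. A finite value is therefore impossible.\<close>

lemma nn_integral_inverse_square_at_infinity:
  "(\<integral>\<^sup>+z. ennreal (1 / (cmod z)\<^sup>2) * indicator {z. 1 \<le> cmod z} z \<partial>lborel) = \<infinity>" (is "?I = _")
proof (rule ccontr)
  assume fin: "?I \<noteq> \<infinity>"
  define J where "J = (\<integral>\<^sup>+z. ennreal (1 / (cmod z)\<^sup>2) * indicator {z. 1 \<le> cmod z \<and> cmod z < 2} z \<partial>lborel)"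
  have [measurable]: "{z::complex. 1 \<le> cmod z} \<in> sets borel" "{z::complex. 2 \<le> cmod z} \<in> sets borel"
    "{z::complex. 1 \<le> cmod z \<and> cmod z < 2} \<in> sets borel"
    by (auto intro!: borel_closed closed_Collect_le continuous_intros)
  have "?I = (\<integral>\<^sup>+z. (ennreal (1 / (cmod z)\<^sup>2) * indicator {z. 1 \<le> cmod z \<and> cmod z < 2} z
      + ennreal (1 / (cmod z)\<^sup>2) * indicator {z. 2 \<le> cmod z} z) \<partial>lborel)"
    by (rule nn_integral_cong) (auto simp: indicator_def)
  also have "\<dots> = J + (\<integral>\<^sup>+z. ennreal (1 / (cmod z)\<^sup>2) * indicator {z. 2 \<le> cmod z} z \<partial>lborel)"
    unfolding J_def by (rule nn_integral_add) measurable
  also have "(\<integral>\<^sup>+z. ennreal (1 / (cmod z)\<^sup>2) * indicator {z. 2 \<le> cmod z} z \<partial>lborel)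
      = ennreal ((cmod 2)\<^sup>2) * (\<integral>\<^sup>+z. ennreal (1 / (cmod (2 * z))\<^sup>2) * indicator {z. 2 \<le> cmod z} (2 * z) \<partial>lborel)"
    by (rule nn_integral_complex_mult) auto
  also have "\<dots> = (\<integral>\<^sup>+z. ennreal ((cmod 2)\<^sup>2) * (ennreal (1 / (cmod (2 * z))\<^sup>2) * indicator {z. 2 \<le> cmod z} (2 * z)) \<partial>lborel)"
    by (rule nn_integral_cmult[symmetric]) measurable
  also have "\<dots> = ?I"
  proof (rule nn_integral_cong)
    fix z :: complex
    have scale: "ennreal ((cmod 2)\<^sup>2) * ennreal (1 / (cmod (2 * z))\<^sup>2) = ennreal (1 / (cmod z)\<^sup>2)"
      by (subst ennreal_mult[symmetric]) (auto simp: norm_mult power_mult_distrib)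
    have ind: "indicator {z. 2 \<le> cmod z} (2 * z) = (indicator {z. 1 \<le> cmod z} z :: ennreal)"
      by (simp add: indicator_def norm_mult)
    show "ennreal ((cmod 2)\<^sup>2) * (ennreal (1 / (cmod (2 * z))\<^sup>2) * indicator {z. 2 \<le> cmod z} (2 * z))
        = ennreal (1 / (cmod z)\<^sup>2) * indicator {z. 1 \<le> cmod z} z"
      unfolding ind scale[symmetric] by (rule mult.assoc[symmetric])
  qed
  finally have "?I = J + ?I" .
  then have "?I + J = ?I + 0" by (simp add: add.commute)
  with fin have "J = 0" unfolding ennreal_add_left_cancel by auto
  have "ball (3/2) (1/2) \<subseteq> {z::complex. 1 \<le> cmod z \<and> cmod z < 2}"
  proof
    fix z :: complex assume "z \<in> ball (3/2) (1/2)"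
    then have "\<bar>cmod (3/2) - cmod z\<bar> < 1/2"
      using norm_triangle_ineq3[of "3/2" z] unfolding mem_ball dist_norm by linarith
    then have "\<bar>3/2 - cmod z\<bar> < 1/2" by (simp add: norm_divide)
    then have "1 \<le> cmod z" "cmod z < 2" by linarith+
    then show "z \<in> {z. 1 \<le> cmod z \<and> cmod z < 2}" by simp
  qed
  moreover have "1/4 \<le> 1 / (cmod z)\<^sup>2" if "1 \<le> cmod z" "cmod z < 2" for z
  proof -
    have "(cmod z)\<^sup>2 \<le> 2\<^sup>2" using that by (intro power_mono) auto
    moreover have "0 < (cmod z)\<^sup>2" using that by (intro zero_less_power) linarith
    ultimately show ?thesis by (simp add: le_divide_eq)
  qed
  ultimately have "(\<integral>\<^sup>+z. ennreal (1/4) * indicator (ball (3/2) (1/2)) (z::complex) \<partial>lborel) \<le> J"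
    unfolding J_def by (intro nn_integral_mono) (auto simp: indicator_def intro!: ennreal_leI)
  then have "ennreal (1/4) * emeasure lborel (ball (3/2::complex) (1/2)) \<le> 0"
    using \<open>J = 0\<close> by (simp add: nn_integral_cmult_indicator)
  then show False using unit_ball_vol_pos[of 2] by (simp add: emeasure_ball)
qed

text \<open>Near \<open>u0\<close> the function \<open>u \<mapsto> P (1, u)\<close> is bounded away from 0. Over each \<open>z\<close> with \<open>\<bar>z\<bar> \<ge> 1\<close>, substituting \<open>w = z u\<close>
  and restricting \<open>u\<close> to the part of the thin annulus near \<open>u0\<close> bounds the inner integral below by a constant times
  \<open>\<bar>z\<bar> powr (2 + 2m - 2 - 2\<alpha>)\<close>, where the exponents come from the Jacobian, homogeneity, and the area of the annulus.\<close>

lemma nn_integral_homog_diverges: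
  fixes P :: "complex^2 \<Rightarrow> complex"
  assumes \<alpha>: "0 \<le> \<alpha>" "\<alpha> \<le> 1 + real m"
    and cont: "continuous_on (D_alpha \<alpha>) P"
    and hom: "\<And>p c. p \<in> D_alpha \<alpha> \<Longrightarrow> c *s p \<in> D_alpha \<alpha> \<Longrightarrow> P (c *s p) = c ^ m * P p"
    and u0: "cmod u0 = 1" "P (vec2 1 u0) \<noteq> 0"
  shows "(\<integral>\<^sup>+p. ennreal ((cmod (P p))\<^sup>2) * indicator (D_alpha \<alpha>) p \<partial>lborel) = \<infinity>"
proof -
  let ?D = "D_alpha \<alpha>"
  define H where "H = (\<lambda>p. ennreal ((cmod (P p))\<^sup>2) * indicator ?D p)"
  have [measurable]: "?D \<in> sets borel" using open_D_alpha by auto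
  have "(\<lambda>p. indicator ?D p *\<^sub>R P p) \<in> borel_measurable borel"
    by (rule borel_measurable_continuous_on_indicator[OF _ cont]) simp
  then have "(\<lambda>p. ennreal ((cmod (indicator ?D p *\<^sub>R P p))\<^sup>2)) \<in> borel_measurable borel"
    by measurable
  also have "(\<lambda>p. ennreal ((cmod (indicator ?D p *\<^sub>R P p))\<^sup>2)) = H"
    by (auto simp: H_def fun_eq_iff indicator_def)
  finally have H[measurable]: "H \<in> borel_measurable borel" .
  define \<delta> where "\<delta> = (cmod (P (vec2 1 u0)))\<^sup>2 / 2"
  have \<delta>: "\<delta> > 0" using u0 by (simp add: \<delta>_def)
  define W where "W = {u. vec2 1 u \<in> ?D}"
  have contv: "continuous_on UNIV (\<lambda>u. vec2 1 u)" by (intro continuous_intros)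
  have "open W" using open_vimage[OF open_D_alpha contv] by (simp add: W_def vimage_def)
  have contW: "continuous_on W (\<lambda>u. (cmod (P (vec2 1 u)))\<^sup>2)"
    by (intro continuous_intros continuous_on_compose2[OF cont])  (auto simp: W_def)
  then have "open (W \<inter> (\<lambda>u. (cmod (P (vec2 1 u)))\<^sup>2) -` {\<delta><..})"
    using \<open>open W\<close> by (simp add: continuous_on_open_vimage Int_commute)
  moreover have "u0 \<in> W \<inter> (\<lambda>u. (cmod (P (vec2 1 u)))\<^sup>2) -` {\<delta><..}"
    using u0 by (auto simp: W_def \<delta>_def intro: diagonal_in_D_alpha)
  ultimately obtain \<eta>' where \<eta>': "\<eta>' > 0" "ball u0 \<eta>' \<subseteq> W \<inter> (\<lambda>u. (cmod (P (vec2 1 u)))\<^sup>2) -` {\<delta><..}"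
    by (metis open_contains_ball)
  define \<eta> where "\<eta> = min \<eta>' 1"
  have \<eta>: "0 < \<eta>" "\<eta> \<le> 1" using \<eta>' by (auto simp: \<eta>_def)
  have near: "vec2 1 u \<in> ?D" "\<delta> < (cmod (P (vec2 1 u)))\<^sup>2" if "dist u0 u < \<eta>" for u
  proof -
    have "u \<in> ball u0 \<eta>'" using that by (simp add: \<eta>_def)
    with \<eta>' show "vec2 1 u \<in> ?D" "\<delta> < (cmod (P (vec2 1 u)))\<^sup>2" by (auto simp: W_def)
  qed
  define C where "C = \<delta> * \<eta> * \<eta> * 6 powr (- \<alpha>) / 4"
  have C: "C > 0" using \<delta> \<eta> by (simp add: C_def)
  have fibre: "ennreal C * ennreal (1 / (cmod z)\<^sup>2) \<le> (\<integral>\<^sup>+w. H (vec2 z w) \<partial>lborel)" if z: "1 \<le> cmod z" for z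
  proof -
    define \<rho> where "\<rho> = cmod z"
    have \<rho>: "1 \<le> \<rho>" "0 < \<rho>" using z by (auto simp: \<rho>_def)
    define \<tau> where "\<tau> = \<eta> * (6 powr (- \<alpha>) * \<rho> powr (- 2 - 2 * \<alpha>))"
    have le1: "6 powr (- \<alpha>) * \<rho> powr (- 2 - 2 * \<alpha>) \<le> 1 * 1"
      using \<alpha> \<rho> by (intro mult_mono powr_le_1_neg) auto
    have \<tau>: "0 < \<tau>" "\<tau> \<le> \<eta>" "\<tau> \<le> 6 powr (- \<alpha>) * \<rho> powr (- 2 - 2 * \<alpha>)"
      using \<eta> \<rho> le1 by (auto simp: \<tau>_def mult_le_cancel_left1 mult_le_cancel_right1)
    define S where "S = {u. dist u0 u < \<eta> \<and> \<bar>(cmod u)\<^sup>2 - 1\<bar> < \<tau>}"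
    have "open S" unfolding S_def
      by (intro open_Collect_conj open_Collect_less continuous_intros)
    then have [measurable]: "S \<in> sets borel" by auto
    have pw: "ennreal (\<rho> ^ (2 * m) * \<delta>) * indicator S u \<le> H (vec2 z (z * u))" for u
    proof (cases "u \<in> S")
      case True
      then have u: "dist u0 u < \<eta>" "\<bar>(cmod u)\<^sup>2 - 1\<bar> < \<tau>" by (auto simp: S_def)
      have inD: "vec2 z (z * u) \<in> ?D"
        using u \<tau> by (intro thin_annulus_in_D_alpha \<alpha> z) (auto simp: \<rho>_def)
      have eq: "vec2 z (z * u) = z *s vec2 1 u" by (simp add: vec2_smult)
      have "cmod (P (vec2 z (z * u))) = \<rho> ^ m * cmod (P (vec2 1 u))"
        unfolding eq using hom[OF near(1)[OF u(1)]] inD by (simp add: eq norm_mult norm_power \<rho>_def)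
      then have "(cmod (P (vec2 z (z * u))))\<^sup>2 = \<rho> ^ (2 * m) * (cmod (P (vec2 1 u)))\<^sup>2"
        by (simp add: power_mult_distrib power_even_eq mult.commute[of 2 m] power_mult)
      also have "\<dots> \<ge> \<rho> ^ (2 * m) * \<delta>"
        using near(2)[OF u(1)] \<rho> by (intro mult_left_mono) auto
      finally show ?thesis using True inD by (simp add: H_def ennreal_leI)
    qed simp
    \<comment> \<open>This is where the degree enters: \<open>2 m - 2 \<alpha> \<ge> - 2\<close>.\<close>
    have "\<rho> powr (- 2) \<le> \<rho> powr (2 * real m - 2 * \<alpha>)"
      using \<alpha> \<rho> by (intro powr_mono) auto
    also have "\<dots> = \<rho> powr 2 * \<rho> powr (2 * real m) * \<rho> powr (- 2 - 2 * \<alpha>)"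
      by (simp only: powr_add[symmetric]) simp
    also have "\<rho> powr (2 * real m) = \<rho> ^ (2 * m)"
      using \<rho> powr_realpow[of \<rho> "2 * m"] by simp
    finally have "1 / \<rho>\<^sup>2 \<le> \<rho>\<^sup>2 * \<rho> ^ (2 * m) * \<rho> powr (- 2 - 2 * \<alpha>)"
      using \<rho> by (simp add: powr_minus_divide)
    then have "C * (1 / \<rho>\<^sup>2) \<le> C * (\<rho>\<^sup>2 * \<rho> ^ (2 * m) * \<rho> powr (- 2 - 2 * \<alpha>))"
      using C by (intro mult_left_mono) auto
    also have "\<dots> = \<rho>\<^sup>2 * (\<rho> ^ (2 * m) * \<delta> * (\<eta> * \<tau> / 4))"
      by (simp add: C_def \<tau>_def)
    finally have "ennreal C * ennreal (1 / \<rho>\<^sup>2) \<le> ennreal (\<rho>\<^sup>2 * (\<rho> ^ (2 * m) * \<delta> * (\<eta> * \<tau> / 4)))"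
      using C by (simp add: ennreal_leI flip: ennreal_mult)
    also have "\<dots> = ennreal (\<rho>\<^sup>2) * (ennreal (\<rho> ^ (2 * m) * \<delta>) * ennreal (\<eta> * \<tau> / 4))"
    proof -
      have split3: "ennreal (a * (b * c)) = ennreal a * (ennreal b * ennreal c)" if "0 \<le> a" "0 \<le> b" "0 \<le> c" for a b c
        using that by (simp add: ennreal_mult)
      show ?thesis using \<delta> \<eta> \<tau> \<rho> by (intro split3) auto
    qed
    also have "\<dots> \<le> ennreal (\<rho>\<^sup>2) * (ennreal (\<rho> ^ (2 * m) * \<delta>) * emeasure lborel S)"
      unfolding S_def by (intro mult_left_mono emeasure_thin_annulus_ge u0 \<eta> \<tau>) auto
    also have "\<dots> = ennreal (\<rho>\<^sup>2) * (\<integral>\<^sup>+u. ennreal (\<rho> ^ (2 * m) * \<delta>) * indicator S u \<partial>lborel)"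
      by (subst nn_integral_cmult_indicator) auto
    also have "\<dots> \<le> ennreal (\<rho>\<^sup>2) * (\<integral>\<^sup>+u. H (vec2 z (z * u)) \<partial>lborel)"
      by (intro mult_left_mono nn_integral_mono pw) auto
    also have "\<dots> = (\<integral>\<^sup>+w. H (vec2 z w) \<partial>lborel)"
      using z unfolding \<rho>_def by (intro nn_integral_complex_mult[symmetric, where g="\<lambda>w. H (vec2 z w)"]) auto
    finally show ?thesis by (simp add: \<rho>_def)
  qed
  have [measurable]: "{z::complex. 1 \<le> cmod z} \<in> sets borel"
    by (auto intro!: borel_closed closed_Collect_le continuous_intros)
  have "ennreal C * (\<integral>\<^sup>+z. ennreal (1 / (cmod z)\<^sup>2) * indicator {z. 1 \<le> cmod z} z \<partial>lborel)
     = (\<integral>\<^sup>+z. ennreal C * (ennreal (1 / (cmod z)\<^sup>2) * indicator {z. 1 \<le> cmod z} z) \<partial>lborel)"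
    by (rule nn_integral_cmult[symmetric]) measurable
  also have "\<dots> \<le> (\<integral>\<^sup>+z. \<integral>\<^sup>+w. H (vec2 z w) \<partial>lborel \<partial>lborel)"
    by (rule nn_integral_mono) (use fibre in \<open>auto simp: indicator_def\<close>)
  also have "\<dots> = (\<integral>\<^sup>+p. H p \<partial>lborel)"
    by (rule nn_integral_lborel_vec2[symmetric]) measurable
  finally show ?thesis
    using C by (simp add: nn_integral_inverse_square_at_infinity H_def ennreal_mult_top top_unique)
qed

section \<open>A uniqueness theorem and the reduction to affine functions\<close>

lemma islimpt_sphere_1: "(1::complex) islimpt sphere 0 1"
proof -
  have "sphere (0::complex) 1 \<noteq> {a}" for a
  proof
    assume a: "sphere (0::complex) 1 = {a}"
    have "1 \<in> sphere (0::complex) 1" "- 1 \<in> sphere (0::complex) 1" by auto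
    then show False unfolding a by simp
  qed
  then show ?thesis
    by (intro connected_imp_perfect) (auto simp: connected_sphere)
qed

text \<open>On the complex line \<open>u \<mapsto> (z, z u)\<close> the hypothesis concerns the unit circle, which has limit points, so \<open>g\<close> vanishes
  for \<open>\<bar>u\<bar> < 2\<close> as long as this disc stays in \<open>D\<close>; the same holds with the roles of \<open>z\<close> and \<open>w\<close> exchanged. Together these
  lines cover a neighbourhood of 0, and along the rays of the balanced domain the vanishing spreads to all of \<open>D\<close>.\<close>

lemma holomorphic_vanishes_if_vanishes_on_diagonal:
  fixes D :: "(complex^2) set"
  assumes D: "open D" "0 \<in> D" and bal: "balanced D" and g: "holomorphic_vec_on g D"
    and diag: "\<And>p. p \<in> D \<Longrightarrow> cmod (p $ 1) = cmod (p $ 2) \<Longrightarrow> g p = 0"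
    and p: "p \<in> D"
  shows "g p = 0"
proof -
  obtain e where e: "e > 0" "ball 0 e \<subseteq> D" using D open_contains_ball by blast
  have nrm: "norm q \<le> cmod (q $ 1) + cmod (q $ 2)" for q :: "complex^2"
    using norm_vec_def[of q] L2_set_le_sum[of UNIV "\<lambda>i. cmod (q $ i)"] by (simp add: sum_2)
  have slice0: "g (a + u *s b) = 0"
    if ab: "\<And>u. cmod u < 2 \<Longrightarrow> a + u *s b \<in> D" 
      "\<And>u. cmod u = 1 \<Longrightarrow> cmod ((a + u *s b) $ 1) = cmod ((a + u *s b) $ 2)" and u: "cmod u < 2" for a b u
  proof (rule analytic_continuation[where S="ball 0 2" and U="sphere 0 1" and \<xi>=1 and f="\<lambda>u. g (a + u *s b)"])
    show "(\<lambda>u. g (a + u *s b)) holomorphic_on ball 0 2"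
      by (rule holomorphic_on_subset[OF holomorphic_slice[OF D(1) g]]) (auto simp: ab)
    show "g (a + z *s b) = 0" if "z \<in> sphere 0 1" for z
      using that by (intro diag ab) auto
  qed (use u islimpt_sphere_1 in auto)
  \<comment> \<open>If \<open>z\<close> has modulus below \<open>e / 3\<close>, the disc \<open>\<bar>u\<bar> < 2\<close> is mapped by \<open>u \<mapsto> (z, z u)\<close> into the ball of radius \<open>e\<close>.\<close>
  have near0: "g q = 0" if q: "norm q < e / 3" for q
  proof -
    have c: "cmod (q $ i) < e / 3" for i using q component_le_norm_cart Finite_Cartesian_Product.norm_nth_le[of q i] by linarith
    have mono: "cmod u < 2 \<Longrightarrow> cmod (u * q $ i) \<le> 2 * cmod (q $ i)" for u i
      unfolding norm_mult by (intro mult_right_mono) auto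
    consider "q = 0" | "q $ 1 \<noteq> 0" "cmod (q $ 2) \<le> cmod (q $ 1)" | "q $ 2 \<noteq> 0" "cmod (q $ 1) \<le> cmod (q $ 2)"
    proof -
      have "q = 0" if "q $ 1 = 0" "q $ 2 = 0" using that by (simp add: vec_eq_iff forall_2)
      then show thesis using that by (metis linorder_le_cases norm_le_zero_iff norm_zero)
    qed
    then show ?thesis
    proof cases
      case 1
      then show ?thesis using diag[of 0] D by simp
    next
      case 2
      have eq: "q = vec2 (q $ 1) 0 + (q $ 2 / q $ 1) *s vec2 0 (q $ 1)"
        using 2 by (simp add: vec_eq_iff forall_2)
      have pos: "0 < cmod (q $ 1)" using 2 by simp
      then have "cmod (q $ 2) < 2 * cmod (q $ 1)" using 2 by linarith
      then have lt: "cmod (q $ 2 / q $ 1) < 2"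
        using pos unfolding norm_divide by (simp add: divide_less_eq)
      show ?thesis
      proof (subst eq, rule slice0)
        fix u :: complex assume u: "cmod u < 2"
        have "norm (vec2 (q $ 1) 0 + u *s vec2 0 (q $ 1)) \<le> cmod (q $ 1) + cmod (u * q $ 1)"
          using nrm[of "vec2 (q $ 1) 0 + u *s vec2 0 (q $ 1)"] by simp
        also have "\<dots> < e" using mono[OF u, of 1] c[of 1] by linarith
        finally show "vec2 (q $ 1) 0 + u *s vec2 0 (q $ 1) \<in> D" using e by auto
      qed (use lt in \<open>auto simp: norm_mult\<close>)
    next
      case 3
      have eq: "q = vec2 0 (q $ 2) + (q $ 1 / q $ 2) *s vec2 (q $ 2) 0"
        using 3 by (simp add: vec_eq_iff forall_2)
      have pos: "0 < cmod (q $ 2)" using 3 by simp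
      then have "cmod (q $ 1) < 2 * cmod (q $ 2)" using 3 by linarith
      then have lt: "cmod (q $ 1 / q $ 2) < 2"
        using pos unfolding norm_divide by (simp add: divide_less_eq)
      show ?thesis
      proof (subst eq, rule slice0)
        fix u :: complex assume u: "cmod u < 2"
        have "norm (vec2 0 (q $ 2) + u *s vec2 (q $ 2) 0) \<le> cmod (u * q $ 2) + cmod (q $ 2)"
          using nrm[of "vec2 0 (q $ 2) + u *s vec2 (q $ 2) 0"] by simp
        also have "\<dots> < e" using mono[OF u, of 2] c[of 2] by linarith
        finally show "vec2 0 (q $ 2) + u *s vec2 (q $ 2) 0 \<in> D" using e by auto
      qed (use lt in \<open>auto simp: norm_mult\<close>)
    qed
  qed
  obtain r where r: "r > 1" "ball 0 r \<subseteq> {l. l *s p \<in> D}" using ray_ball[OF D(1) bal p] .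
  have cont: "continuous_on UNIV (\<lambda>l. l *s p)" by (intro continuous_intros)
  have "open ((\<lambda>l. l *s p) -` ball 0 (e/3))" by (intro open_vimage cont) auto
  moreover have "0 \<in> (\<lambda>l. l *s p) -` ball 0 (e/3)" using e by simp
  ultimately have open_small: "open ((\<lambda>l. l *s p) -` ball 0 (e/3) \<inter> ball 0 r)" "0 \<in> (\<lambda>l. l *s p) -` ball 0 (e/3) \<inter> ball 0 r"
    using r by auto
  have "g (1 *s p) = 0"
  proof (rule analytic_continuation[where S="ball 0 r" and U="(\<lambda>l. l *s p) -` ball 0 (e/3) \<inter> ball 0 r" and \<xi>=0 and f="\<lambda>l. g (l *s p)"])
    show "(\<lambda>l. g (l *s p)) holomorphic_on ball 0 r"
      using holomorphic_ray[OF D(1) bal g] r holomorphic_on_subset by blast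
    show "0 islimpt (\<lambda>l. l *s p) -` ball 0 (e/3) \<inter> ball 0 r"
      using open_small by (intro interior_limit_point) (simp only: interior_open)
  qed (use r near0 in auto)
  then show ?thesis by simp
qed

text \<open>Subtracting from \<open>f\<close> its affine part at 0 leaves a function that vanishes where \<open>\<bar>z\<bar> = \<bar>w\<bar>\<close>, because all
  homogeneous parts of higher degree vanish there.\<close>

lemma square_integrable_holomorphic_affine:
  assumes \<alpha>: "2 < \<alpha>" "\<alpha> < 3" and f: "f \<in> bergman_space (D_alpha \<alpha>)"
  shows "\<exists>a b c. \<forall>p\<in>D_alpha \<alpha>. f p = a + b * p $ 1 + c * p $ 2"
proof -
  let ?D = "D_alpha \<alpha>"
  have hol: "holomorphic_vec_on f ?D" and int: "set_integrable lborel ?D (\<lambda>p. (cmod (f p))\<^sup>2)"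
    using f by (auto simp: bergman_space_def)
  have bal: "balanced ?D" using \<alpha> by (intro balanced_D_alpha) simp
  note D = open_D_alpha[of \<alpha>] bal hol
  have "(\<integral>\<^sup>+p. ennreal ((cmod (f p))\<^sup>2) * indicator ?D p \<partial>lborel) = (\<integral>\<^sup>+p. ennreal (norm (indicator ?D p *\<^sub>R (cmod (f p))\<^sup>2)) \<partial>lborel)"
    by (rule nn_integral_cong) (auto simp: indicator_def)
  also have "\<dots> < \<infinity>" using int unfolding set_integrable_def by (simp add: integrable_iff_bounded)
  finally have fin: "(\<integral>\<^sup>+p. ennreal ((cmod (f p))\<^sup>2) * indicator ?D p \<partial>lborel) < \<infinity>" .
  have circle: "homog_part m f (vec2 1 u) = 0" if m: "2 \<le> m" and u: "cmod u = 1" for m u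
  proof (rule ccontr)
    assume "homog_part m f (vec2 1 u) \<noteq> 0"
    then have "(\<integral>\<^sup>+p. ennreal ((cmod (homog_part m f p))\<^sup>2) * indicator ?D p \<partial>lborel) = \<infinity>"
      using \<alpha> m u
      by (intro nn_integral_homog_diverges[of \<alpha> m _ u] continuous_on_homog_part[OF D] homog_part_smult[OF D]) auto
    then show False using homog_part_L2_le[OF D, of m] fin by simp
  qed
  obtain f' where f': "(f has_derivative f') (at 0)" "\<And>c v. f' (c *s v) = c * f' v"
    using hol zero_in_D_alpha[of \<alpha>] open_D_alpha[of \<alpha>] unfolding holomorphic_vec_on_def by (metis at_within_open)
  have lin: "linear f'" using f'(1) by (rule has_derivative_linear)
  define g where "g = (\<lambda>p. f p - f 0 - f' p)"
  have "holomorphic_vec_on g ?D"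
    unfolding holomorphic_vec_on_def
  proof
    fix p assume "p \<in> ?D"
    then obtain h where h: "(f has_derivative h) (at p within ?D)" "\<And>c v. h (c *s v) = c * h v"
      using hol unfolding holomorphic_vec_on_def by blast
    have "(g has_derivative (\<lambda>v. h v - 0 - f' v)) (at p within ?D)"
      unfolding g_def using lin
      by (intro has_derivative_diff has_derivative_const h bounded_linear_imp_has_derivative)
        (simp add: linear_conv_bounded_linear)
    moreover have "h (c *s v) - 0 - f' (c *s v) = c * (h v - 0 - f' v)" for c v
      by (simp add: h f' algebra_simps)
    ultimately show "\<exists>g'. (g has_derivative g') (at p within ?D) \<and> (\<forall>c v. g' (c *s v) = c * g' v)"
      by blast
  qed
  moreover have "g p = 0" if p: "p \<in> ?D" and d: "cmod (p $ 1) = cmod (p $ 2)" for p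
  proof (cases "p $ 1 = 0")
    case True
    then have "p = 0" using d by (simp add: vec_eq_iff forall_2)
    then show ?thesis using linear_0[OF lin] by (simp add: g_def)
  next
    case False
    define u where "u = p $ 2 / p $ 1"
    have "p $ 2 \<noteq> 0" using d False by (metis norm_eq_zero)
    then have u: "cmod u = 1" using d False by (simp add: u_def norm_divide)
    have eq: "p = p $ 1 *s vec2 1 u" using False by (simp add: vec_eq_iff forall_2 u_def)
    have v: "vec2 1 u \<in> ?D" using u by (intro diagonal_in_D_alpha) simp
    have "homog_part m f p = 0" if "2 \<le> m" for m
    proof -
      have "p $ 1 *s vec2 1 u \<in> ?D" using p by (simp only: eq[symmetric])
      from homog_part_smult[OF D v this, of m] show ?thesis
        by (simp only: eq[symmetric] circle[OF that u] mult_zero_right)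
    qed
    then have "f p = f 0 + f' p"
      by (rule eq_affine_if_homog_parts_vanish[OF D p _ f'])
    then show ?thesis by (simp add: g_def)
  qed
  ultimately have g0: "g p = 0" if "p \<in> ?D" for p
    using holomorphic_vanishes_if_vanishes_on_diagonal[OF open_D_alpha zero_in_D_alpha bal] that by blast
  define b c where "b = f' (vec2 1 0)" and "c = f' (vec2 0 1)"
  have "f p = f 0 + b * p $ 1 + c * p $ 2" if p: "p \<in> ?D" for p
  proof -
    have "p = p $ 1 *s vec2 1 0 + p $ 2 *s vec2 0 1" by (simp add: vec_eq_iff forall_2)
    then have "f' p = f' (p $ 1 *s vec2 1 0 + p $ 2 *s vec2 0 1)" by (rule arg_cong)
    also have "\<dots> = b * p $ 1 + c * p $ 2"
      unfolding linear_add[OF lin] f' b_def c_def by (simp add: mult.commute)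
    finally show ?thesis using g0[OF p] by (simp add: g_def algebra_simps)
  qed
  then show ?thesis by blast
qed

section \<open>Integrability of the affine functions\<close>

lemma nn_integral_real_decay_finite:
  fixes \<beta> :: real
  assumes \<beta>: "1 < \<beta>"
  shows "(\<integral>\<^sup>+x. ennreal ((1 + x\<^sup>2) powr (- \<beta> / 2)) \<partial>lborel) < \<infinity>"
proof -
  define h where "h = (\<lambda>x::real. ennreal ((1 + x) powr (- \<beta>)) * indicator {0..} x)"
  have [measurable]: "h \<in> borel_measurable borel" by (simp add: h_def)
  define F where "F = (\<lambda>x::real. - ((1 + x) powr (1 - \<beta>) / (\<beta> - 1)))"
  have lim: "(F \<longlongrightarrow> 0) at_top"
  proof -
    have "filterlim (\<lambda>x::real. 1 + x) at_top at_top"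
      by (rule filterlim_tendsto_add_at_top[OF tendsto_const filterlim_ident])
    then have "((\<lambda>x::real. (1 + x) powr (1 - \<beta>)) \<longlongrightarrow> 0) at_top"
      using \<beta> by (intro tendsto_neg_powr) auto
    from tendsto_minus[OF tendsto_divide[OF this tendsto_const, of "\<beta> - 1"]] show ?thesis
      using \<beta> by (simp add: F_def)
  qed
  have deriv: "(F has_real_derivative (1 + x) powr (- \<beta>)) (at x)" if "0 \<le> x" for x
  proof -
    have "((\<lambda>y. (1 + y) powr (1 - \<beta>)) has_real_derivative
        ((1 - \<beta>) * (1 + x) powr (1 - \<beta> - 1)) * (0 + 1)) (at x)"
      by (rule DERIV_chain2[where f="\<lambda>y. y powr (1 - \<beta>)"], rule has_real_derivative_powr)
        (use that in simp, rule DERIV_add, rule DERIV_const, rule DERIV_ident)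
    then have "((\<lambda>y. (1 + y) powr (1 - \<beta>)) has_real_derivative (1 - \<beta>) * (1 + x) powr (- \<beta>)) (at x)"
      by simp
    from DERIV_minus[OF DERIV_cdivide[OF this, of "\<beta> - 1"]] show ?thesis
      unfolding F_def
    proof (rule DERIV_cong)
      have "- ((1 - \<beta>) * (1 + x) powr - \<beta> / (\<beta> - 1)) = (1 + x) powr - \<beta> * (\<beta> - 1) / (\<beta> - 1)"
        by (simp add: minus_divide_left left_diff_distrib right_diff_distrib)
      also have "\<dots> = (1 + x) powr - \<beta>"
        using \<beta> by (intro nonzero_mult_div_cancel_right) auto
      finally show "- ((1 - \<beta>) * (1 + x) powr - \<beta> / (\<beta> - 1)) = (1 + x) powr - \<beta>" .
    qed
  qed
  have "(\<integral>\<^sup>+x. h x \<partial>lborel) = ennreal (0 - F 0)"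
    unfolding h_def by (rule nn_integral_FTC_atLeast[OF _ deriv _ lim]) auto
  then have h: "(\<integral>\<^sup>+x. h x \<partial>lborel) < \<infinity>" by simp
  have h': "(\<integral>\<^sup>+x. h (- x) \<partial>lborel) = (\<integral>\<^sup>+x. h x \<partial>lborel)"
    by (subst (2) nn_integral_real_affine[where c="-1" and t=0]) auto
  have "(\<integral>\<^sup>+x. ennreal ((1 + x\<^sup>2) powr (- \<beta> / 2)) \<partial>lborel)
      \<le> (\<integral>\<^sup>+x. ennreal (2 powr (\<beta> / 2)) * (h x + h (- x)) \<partial>lborel)"
  proof (rule nn_integral_mono)
    fix x :: real
    have "(1 + \<bar>x\<bar>)\<^sup>2 / 2 \<le> 1 + x\<^sup>2"
      using zero_le_power2[of "1 - \<bar>x\<bar>"] by (simp add: power2_eq_square algebra_simps)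
    then have "(1 + x\<^sup>2) powr (- \<beta> / 2) \<le> ((1 + \<bar>x\<bar>)\<^sup>2 / 2) powr (- \<beta> / 2)"
    proof (intro powr_mono2')
      have "0 < 1 + \<bar>x\<bar>" by linarith
      then show "0 < (1 + \<bar>x\<bar>)\<^sup>2 / 2" by simp
    qed (use \<beta> in auto)
    also have "\<dots> = ((1 + \<bar>x\<bar>) powr 2) powr (- \<beta> / 2) * (1 / 2) powr (- \<beta> / 2)"
      by (simp flip: powr_mult)
    also have "(1 / 2) powr (- \<beta> / 2) = 2 powr (\<beta> / 2)"
      by (simp add: powr_divide powr_minus_divide)
    also have "((1 + \<bar>x\<bar>) powr 2) powr (- \<beta> / 2) = (1 + \<bar>x\<bar>) powr (- \<beta>)"
      by (simp only: powr_powr) simp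
    finally have "ennreal ((1 + x\<^sup>2) powr (- \<beta> / 2)) \<le> ennreal (2 powr (\<beta> / 2)) * ennreal ((1 + \<bar>x\<bar>) powr (- \<beta>))"
      by (simp add: mult.commute ennreal_leI flip: ennreal_mult)
    also have "\<dots> \<le> ennreal (2 powr (\<beta> / 2)) * (h x + h (- x))"
      by (rule mult_left_mono) (auto simp: h_def indicator_def)
    finally show "ennreal ((1 + x\<^sup>2) powr (- \<beta> / 2)) \<le> ennreal (2 powr (\<beta> / 2)) * (h x + h (- x))" .
  qed
  also have "\<dots> = ennreal (2 powr (\<beta> / 2)) * ((\<integral>\<^sup>+x. h x \<partial>lborel) + (\<integral>\<^sup>+x. h (- x) \<partial>lborel))"
    by (subst nn_integral_cmult, simp, subst nn_integral_add) auto
  also have "\<dots> < \<infinity>"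
    using h unfolding h' by (simp add: ennreal_mult_less_top)
  finally show ?thesis .
qed

text \<open>As \<open>(1 + x\<^sup>2) (1 + y\<^sup>2) \<le> (1 + x\<^sup>2 + y\<^sup>2)\<^sup>2\<close>, the integrand is dominated by a product of functions of one real variable.\<close>

lemma nn_integral_complex_decay_finite:
  fixes \<beta> :: real
  assumes \<beta>: "1 < \<beta>"
  shows "(\<integral>\<^sup>+z. ennreal ((1 + (cmod z)\<^sup>2) powr (- \<beta>)) \<partial>lborel) < \<infinity>"
proof -
  let ?g = "\<lambda>x::real. ennreal ((1 + x\<^sup>2) powr (- \<beta> / 2))"
  have "(\<integral>\<^sup>+z. ennreal ((1 + (cmod z)\<^sup>2) powr (- \<beta>)) \<partial>lborel)
     = (\<integral>\<^sup>+x. \<integral>\<^sup>+y. ennreal ((1 + (cmod (Complex x y))\<^sup>2) powr (- \<beta>)) \<partial>lborel \<partial>lborel)"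
    by (rule nn_integral_lborel_complex) measurable
  also have "\<dots> \<le> (\<integral>\<^sup>+x. \<integral>\<^sup>+y. ?g x * ?g y \<partial>lborel \<partial>lborel)"
  proof (intro nn_integral_mono)
    fix x y :: real
    have pos: "0 < 1 + x\<^sup>2" "0 < 1 + y\<^sup>2" "0 < 1 + (x\<^sup>2 + y\<^sup>2)" by (auto simp: add_pos_nonneg)
    have "(1 + x\<^sup>2) * (1 + y\<^sup>2) \<le> (1 + (x\<^sup>2 + y\<^sup>2)) * (1 + (x\<^sup>2 + y\<^sup>2))"
      by (intro mult_mono) auto
    then have "((1 + (x\<^sup>2 + y\<^sup>2)) powr 2) powr (- \<beta> / 2) \<le> ((1 + x\<^sup>2) * (1 + y\<^sup>2)) powr (- \<beta> / 2)"
      using \<beta> pos by (intro powr_mono2') (auto simp: power2_eq_square)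
    then have "(1 + (x\<^sup>2 + y\<^sup>2)) powr (- \<beta>) \<le> (1 + x\<^sup>2) powr (- \<beta> / 2) * (1 + y\<^sup>2) powr (- \<beta> / 2)"
      using pos by (simp only: powr_powr powr_mult) simp
    then show "ennreal ((1 + (cmod (Complex x y))\<^sup>2) powr (- \<beta>)) \<le> ?g x * ?g y"
      unfolding cmod_power2 by (simp add: ennreal_leI flip: ennreal_mult)
  qed
  also have "\<dots> = (\<integral>\<^sup>+x. ?g x \<partial>lborel) * (\<integral>\<^sup>+y. ?g y \<partial>lborel)"
    by (simp add: nn_integral_cmult nn_integral_multc)
  also have "\<dots> < \<infinity>"
    using nn_integral_real_decay_finite[OF \<beta>] by (simp add: ennreal_mult_less_top)
  finally show ?thesis .
qed

text \<open>The annulus has area exactly \<open>2 \<pi> \<tau>\<close> if \<open>\<tau> \<le> s\<close>; otherwise it is a disc of area \<open>\<pi> (s + \<tau>)\<close>.\<close>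

lemma emeasure_annulus_le:
  assumes s: "0 \<le> s" and \<tau>: "0 < \<tau>"
  shows "emeasure lborel {w::complex. \<bar>(cmod w)\<^sup>2 - s\<bar> < \<tau>} \<le> ennreal (2 * pi * \<tau>)"
proof -
  have eb: "emeasure lborel (ball (0::complex) (sqrt t)) = ennreal (pi * t)" if "0 \<le> t" for t
    using that by (simp add: emeasure_ball unit_ball_vol_2)
  have ec: "emeasure lborel (cball (0::complex) (sqrt t)) = ennreal (pi * t)" if "0 \<le> t" for t
    using that by (simp add: emeasure_cball unit_ball_vol_2)
  have outer: "cmod w < sqrt (s + \<tau>)" if "\<bar>(cmod w)\<^sup>2 - s\<bar> < \<tau>" for w
    using that by (intro real_less_rsqrt) linarith
  show ?thesis
  proof (cases "\<tau> \<le> s")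
    case True
    have inner: "sqrt (s - \<tau>) < cmod w" if "\<bar>(cmod w)\<^sup>2 - s\<bar> < \<tau>" for w
      using that by (intro real_less_lsqrt) auto
    have sub: "cball (0::complex) (sqrt (s - \<tau>)) \<subseteq> ball 0 (sqrt (s + \<tau>))"
    proof -
      have lt: "sqrt (s - \<tau>) < sqrt (s + \<tau>)" using \<tau> by simp
      show ?thesis
      proof
        fix w :: complex assume "w \<in> cball 0 (sqrt (s - \<tau>))"
        then have "cmod w \<le> sqrt (s - \<tau>)" by simp
        also note lt
        finally show "w \<in> ball 0 (sqrt (s + \<tau>))" by simp
      qed
    qed
    have "emeasure lborel {w::complex. \<bar>(cmod w)\<^sup>2 - s\<bar> < \<tau>}
       \<le> emeasure lborel (ball (0::complex) (sqrt (s + \<tau>)) - cball 0 (sqrt (s - \<tau>)))"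
      by (intro emeasure_mono) (auto simp: not_le dest: outer inner)
    also have "\<dots> = emeasure lborel (ball (0::complex) (sqrt (s + \<tau>))) - emeasure lborel (cball (0::complex) (sqrt (s - \<tau>)))"
      using True sub by (intro emeasure_Diff) (auto simp: ec)
    also have "\<dots> = ennreal (pi * (s + \<tau>)) - ennreal (pi * (s - \<tau>))"
      using s \<tau> True by (subst eb, simp, subst ec, simp_all)
    also have "\<dots> = ennreal (pi * (s + \<tau>) - pi * (s - \<tau>))"
      using True by (intro ennreal_minus) simp
    also have "pi * (s + \<tau>) - pi * (s - \<tau>) = 2 * pi * \<tau>"
      by (simp add: algebra_simps)
    finally show ?thesis .
  next
    case False
    have "emeasure lborel {w::complex. \<bar>(cmod w)\<^sup>2 - s\<bar> < \<tau>} \<le> emeasure lborel (ball (0::complex) (sqrt (s + \<tau>)))"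
      using outer by (intro emeasure_mono) auto
    also have "\<dots> \<le> ennreal (2 * pi * \<tau>)"
      using s \<tau> False by (simp add: eb ennreal_leI)
    finally show ?thesis .
  qed
qed

text \<open>The points of \<open>D\<close> over \<open>z\<close> lie in an annulus of area at most \<open>2 \<pi> (1 + \<bar>z\<bar>\<^sup>2) powr (-\<alpha>)\<close>, which leaves an integrand
  of order \<open>1 - \<alpha> < -1\<close> in \<open>1 + \<bar>z\<bar>\<^sup>2\<close>.\<close>

lemma nn_integral_quadratic_D_alpha_finite:
  assumes \<alpha>: "2 < \<alpha>"
  shows "(\<integral>\<^sup>+p. ennreal (1 + (cmod (p $ 1))\<^sup>2) * indicator (D_alpha \<alpha>) p \<partial>lborel) < \<infinity>"
proof -
  have [measurable]: "D_alpha \<alpha> \<in> sets borel" using open_D_alpha by auto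
  have "(\<integral>\<^sup>+p. ennreal (1 + (cmod (p $ 1))\<^sup>2) * indicator (D_alpha \<alpha>) p \<partial>lborel)
     = (\<integral>\<^sup>+z. \<integral>\<^sup>+w. ennreal (1 + (cmod z)\<^sup>2) * indicator (D_alpha \<alpha>) (vec2 z w) \<partial>lborel \<partial>lborel)"
    by (subst nn_integral_lborel_vec2) auto
  also have "\<dots> \<le> (\<integral>\<^sup>+z. ennreal (2 * pi) * ennreal ((1 + (cmod z)\<^sup>2) powr (- (\<alpha> - 1))) \<partial>lborel)"
  proof (rule nn_integral_mono)
    fix z :: complex
    let ?n = "1 + (cmod z)\<^sup>2"
    have n: "?n > 0" by (simp add: add_pos_nonneg)
    define S where "S = {w::complex. \<bar>(cmod w)\<^sup>2 - (cmod z)\<^sup>2\<bar> < ?n powr (- \<alpha>)}"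
    have "open S" unfolding S_def
      by (intro open_Collect_less continuous_intros)
    then have [measurable]: "S \<in> sets borel" by auto
    have inS: "w \<in> S" if "vec2 z w \<in> D_alpha \<alpha>" for w
    proof -
      have "r_fun (vec2 z w) powr (- \<alpha>) \<le> ?n powr (- \<alpha>)"
        using n \<alpha> by (intro powr_mono2') (auto simp: r_fun_def)
      then show ?thesis using that by (simp add: D_alpha_def S_def)
    qed
    have "(\<integral>\<^sup>+w. ennreal ?n * indicator (D_alpha \<alpha>) (vec2 z w) \<partial>lborel) \<le> (\<integral>\<^sup>+w. ennreal ?n * indicator S w \<partial>lborel)"
      by (intro nn_integral_mono mult_left_mono) (auto simp: indicator_def inS)
    also have "\<dots> = ennreal ?n * emeasure lborel S"
      by (rule nn_integral_cmult_indicator) simp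
    also have "\<dots> \<le> ennreal ?n * ennreal (2 * pi * ?n powr (- \<alpha>))"
      unfolding S_def using n by (intro mult_left_mono emeasure_annulus_le) auto
    also have "\<dots> = ennreal (?n * (2 * pi * ?n powr (- \<alpha>)))"
      using n by (intro ennreal_mult[symmetric]) auto
    also have "?n * (2 * pi * ?n powr (- \<alpha>)) = 2 * pi * (?n powr 1 * ?n powr (- \<alpha>))"
      using n by simp
    also have "ennreal \<dots> = ennreal (2 * pi) * ennreal (?n powr 1 * ?n powr (- \<alpha>))"
      by (intro ennreal_mult) auto
    also have "?n powr 1 * ?n powr (- \<alpha>) = ?n powr (- (\<alpha> - 1))"
      by (simp only: powr_add[symmetric]) simp
    finally show "(\<integral>\<^sup>+w. ennreal ?n * indicator (D_alpha \<alpha>) (vec2 z w) \<partial>lborel)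
       \<le> ennreal (2 * pi) * ennreal (?n powr (- (\<alpha> - 1)))" .
  qed
  also have "\<dots> = ennreal (2 * pi) * (\<integral>\<^sup>+z. ennreal ((1 + (cmod z)\<^sup>2) powr (- (\<alpha> - 1))) \<partial>lborel)"
    by (rule nn_integral_cmult) measurable
  also have "\<dots> < \<infinity>"
    using nn_integral_complex_decay_finite[of "\<alpha> - 1"] \<alpha> by (simp add: ennreal_mult_less_top)
  finally show ?thesis .
qed

section \<open>Bergman kernels of finite-dimensional Bergman spaces\<close>

lemma sum_fun_apply: "(\<Sum>a\<in>A. F a) x = (\<Sum>a\<in>A. F a x)"
  for F :: "'a \<Rightarrow> 'b \<Rightarrow> complex"
  by (induction A rule: infinite_finite_induct) auto

lemma cspan_finite_iff:
  assumes "finite B"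
  shows "f \<in> cspan B \<longleftrightarrow> (\<exists>c. f = (\<lambda>p. \<Sum>b\<in>B. c b * b p))"
proof -
  have "(\<Sum>b\<in>B. (\<lambda>p. c b * b p)) = (\<lambda>p. \<Sum>b\<in>B. c b * b p)" for c :: "('a \<Rightarrow> complex) \<Rightarrow> complex"
    by (simp add: fun_eq_iff sum_fun_apply)
  then show ?thesis
    unfolding cfun.span_finite[OF assms] by (auto simp: image_def)
qed

lemma bergman_space_measurable:
  assumes D: "open D" and f: "f \<in> bergman_space D"
  shows "f \<in> borel_measurable borel"
proof -
  have "continuous_on D f" and z: "\<forall>p. p \<notin> D \<longrightarrow> f p = 0"
    using f holomorphic_vec_on_imp_continuous_on by (auto simp: bergman_space_def)
  then have "(\<lambda>p. indicator D p *\<^sub>R f p) \<in> borel_measurable borel"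
    using D by (intro borel_measurable_continuous_on_indicator) auto
  also have "(\<lambda>p. indicator D p *\<^sub>R f p) = f"
    using z by (auto simp: fun_eq_iff indicator_def)
  finally show ?thesis .
qed

lemma bergman_space_integrable:
  assumes f: "f \<in> bergman_space D"
  shows "integrable lborel (\<lambda>p. (cmod (f p))\<^sup>2)"
proof -
  have "(\<lambda>p. indicator D p *\<^sub>R (cmod (f p))\<^sup>2) = (\<lambda>p. (cmod (f p))\<^sup>2)"
    using f by (auto simp: fun_eq_iff indicator_def bergman_space_def)
  then show ?thesis using f by (simp add: bergman_space_def set_integrable_def)
qed

lemma bergman_space_integrable_inner:
  assumes D: "open D" and f: "f \<in> bergman_space D" and g: "g \<in> bergman_space D"
  shows "integrable lborel (\<lambda>p. f p * cnj (g p))"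
proof (rule Bochner_Integration.integrable_bound)
  show "integrable lborel (\<lambda>p. (cmod (f p))\<^sup>2 + (cmod (g p))\<^sup>2)"
    using bergman_space_integrable f g by (intro Bochner_Integration.integrable_add)
  have [measurable]: "f \<in> borel_measurable borel" "g \<in> borel_measurable borel"
    using bergman_space_measurable[OF D] f g by auto
  have [measurable]: "cnj \<in> borel_measurable borel"
    by (rule borel_measurable_continuous_onI) (intro continuous_intros)
  show "(\<lambda>p. f p * cnj (g p)) \<in> borel_measurable lborel" by measurable
  show "AE p in lborel. norm (f p * cnj (g p)) \<le> norm ((cmod (f p))\<^sup>2 + (cmod (g p))\<^sup>2)"
  proof (rule AE_I2)
    fix p
    have "0 \<le> (cmod (f p) - cmod (g p))\<^sup>2 + ((cmod (f p))\<^sup>2 + (cmod (g p))\<^sup>2)" by simp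
    then show "norm (f p * cnj (g p)) \<le> norm ((cmod (f p))\<^sup>2 + (cmod (g p))\<^sup>2)"
      by (simp add: norm_mult power2_eq_square algebra_simps)
  qed
qed

lemma l2_inner_bergman:
  assumes f: "f \<in> bergman_space D"
  shows "l2_inner D f g = (LINT p|lborel. f p * cnj (g p))"
proof -
  have "(\<lambda>p. indicator D p *\<^sub>R (f p * cnj (g p))) = (\<lambda>p. f p * cnj (g p))"
    using f by (auto simp: fun_eq_iff indicator_def bergman_space_def)
  then show ?thesis by (simp add: l2_inner_def set_lebesgue_integral_def)
qed

lemma l2_inner_cnj: "cnj (l2_inner D f g) = l2_inner D g f"
  unfolding l2_inner_def set_lebesgue_integral_def
  by (subst Bochner_Integration.integral_cnj[symmetric]) (simp add: mult.commute)

lemma l2_inner_self: "l2_inner D f f = of_real ((l2_norm D f)\<^sup>2)"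
proof -
  have "0 \<le> (LINT p:D|lborel. (cmod (f p))\<^sup>2)"
    unfolding set_lebesgue_integral_def by (intro integral_nonneg_AE) auto
  moreover have "(\<lambda>p. indicator D p *\<^sub>R (f p * cnj (f p))) = (\<lambda>p. complex_of_real (indicator D p *\<^sub>R (cmod (f p))\<^sup>2))"
    by (auto simp: fun_eq_iff complex_norm_square indicator_def simp del: of_real_power)
  ultimately show ?thesis
    by (simp add: l2_inner_def l2_norm_def set_lebesgue_integral_def del: of_real_power scaleR_conv_of_real real_scaleR_def)
qed

lemma subspace_bergman_space:
  fixes D :: "(complex^'n) set"
  assumes D: "open D"
  shows "cfun.subspace (bergman_space D)"
proof (rule cfun.subspaceI)
  show "0 \<in> bergman_space D"
    unfolding bergman_space_def holomorphic_vec_on_def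
    by (auto simp: zero_fun_def set_integrable_def intro!: exI[of _ "\<lambda>_. 0"])
next
  fix c :: complex and f :: "complex^'n \<Rightarrow> complex" assume f: "f \<in> bergman_space D"
  have "holomorphic_vec_on (\<lambda>p. c * f p) D"
    unfolding holomorphic_vec_on_def
  proof
    fix p assume "p \<in> D"
    then obtain f' where f': "(f has_derivative f') (at p within D)" "\<And>c v. f' (c *s v) = c * f' v"
      using f unfolding bergman_space_def holomorphic_vec_on_def by blast
    show "\<exists>f'. ((\<lambda>p. c * f p) has_derivative f') (at p within D) \<and> (\<forall>c v. f' (c *s v) = c * f' v)"
      using has_derivative_mult_right[OF f'(1), of c] f'(2) by (intro exI[of _ "\<lambda>v. c * f' v"]) simp
  qed
  moreover have "set_integrable lborel D (\<lambda>p. (cmod (c * f p))\<^sup>2)"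
  proof -
    have "integrable lborel (\<lambda>p. (cmod c)\<^sup>2 * (cmod (f p))\<^sup>2)"
      using bergman_space_integrable[OF f] by simp
    moreover have "(\<lambda>p. indicator D p *\<^sub>R (cmod (c * f p))\<^sup>2) = (\<lambda>p. (cmod c)\<^sup>2 * (cmod (f p))\<^sup>2)"
      using f by (auto simp: fun_eq_iff indicator_def norm_mult power_mult_distrib bergman_space_def)
    ultimately show ?thesis by (simp add: set_integrable_def)
  qed
  ultimately show "(\<lambda>p. c * f p) \<in> bergman_space D"
    using f by (auto simp: bergman_space_def)
next
  fix f g :: "complex^'n \<Rightarrow> complex" assume f: "f \<in> bergman_space D" and g: "g \<in> bergman_space D"
  have "holomorphic_vec_on (f + g) D"
    unfolding holomorphic_vec_on_def
  proof
    fix p assume p: "p \<in> D"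
    obtain f' where f': "(f has_derivative f') (at p within D)" "\<And>c v. f' (c *s v) = c * f' v"
      using f p unfolding bergman_space_def holomorphic_vec_on_def by blast
    obtain g' where g': "(g has_derivative g') (at p within D)" "\<And>c v. g' (c *s v) = c * g' v"
      using g p unfolding bergman_space_def holomorphic_vec_on_def by blast
    show "\<exists>f'. ((f + g) has_derivative f') (at p within D) \<and> (\<forall>c v. f' (c *s v) = c * f' v)"
      using has_derivative_add[OF f'(1) g'(1)] f'(2) g'(2)
      by (intro exI[of _ "\<lambda>v. f' v + g' v"]) (simp add: plus_fun_def algebra_simps)
  qed
  moreover have "set_integrable lborel D (\<lambda>p. (cmod ((f + g) p))\<^sup>2)"
    unfolding set_integrable_def
  proof (rule Bochner_Integration.integrable_bound)
    show "integrable lborel (\<lambda>p. 2 * (cmod (f p))\<^sup>2 + 2 * (cmod (g p))\<^sup>2)"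
      using bergman_space_integrable f g by (intro Bochner_Integration.integrable_add integrable_mult_right)
    have [measurable]: "f \<in> borel_measurable borel" "g \<in> borel_measurable borel" "D \<in> sets borel"
      using bergman_space_measurable[OF D] f g D by auto
    show "(\<lambda>p. indicator D p *\<^sub>R (cmod ((f + g) p))\<^sup>2) \<in> borel_measurable lborel"
      unfolding plus_fun_def by measurable
    show "AE p in lborel. norm (indicator D p *\<^sub>R (cmod ((f + g) p))\<^sup>2) \<le> norm (2 * (cmod (f p))\<^sup>2 + 2 * (cmod (g p))\<^sup>2)"
    proof (rule AE_I2)
      fix p
      have "(cmod (f p + g p))\<^sup>2 \<le> (cmod (f p) + cmod (g p))\<^sup>2"
        by (intro power_mono norm_triangle_ineq) auto
      also have "\<dots> \<le> 2 * (cmod (f p))\<^sup>2 + 2 * (cmod (g p))\<^sup>2"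
        using zero_le_power2[of "cmod (f p) - cmod (g p)"] by (simp add: power2_eq_square algebra_simps)
      finally show "norm (indicator D p *\<^sub>R (cmod ((f + g) p))\<^sup>2) \<le> norm (2 * (cmod (f p))\<^sup>2 + 2 * (cmod (g p))\<^sup>2)"
        by (auto simp: indicator_def)
    qed
  qed
  ultimately show "f + g \<in> bergman_space D"
    using f g by (auto simp: bergman_space_def)
qed

lemma l2_inner_diff_left:
  assumes D: "open D" and fgh: "f \<in> bergman_space D" "g \<in> bergman_space D" "h \<in> bergman_space D"
  shows "l2_inner D (f - g) h = l2_inner D f h - l2_inner D g h"
proof -
  have "f - g \<in> bergman_space D"
    by (rule cfun.subspace_diff[OF subspace_bergman_space[OF D]]) (use fgh in auto)
  then show ?thesis
    using bergman_space_integrable_inner[OF D] fgh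
    by (simp add: l2_inner_bergman fun_diff_def left_diff_distrib)
qed

lemma l2_inner_sum_left:
  assumes D: "open D" and B: "finite B" "B \<subseteq> bergman_space D" and g: "g \<in> bergman_space D"
  shows "l2_inner D (\<lambda>p. \<Sum>b\<in>B. c b * b p) g = (\<Sum>b\<in>B. c b * l2_inner D b g)"
proof -
  have mem: "(\<lambda>p. \<Sum>b\<in>B. c b * b p) \<in> bergman_space D"
    using B cspan_finite_iff[OF B(1)] cfun.span_minimal[OF B(2) subspace_bergman_space[OF D]] by blast
  have "l2_inner D (\<lambda>p. \<Sum>b\<in>B. c b * b p) g = (LINT p|lborel. (\<Sum>b\<in>B. c b * (b p * cnj (g p))))"
    unfolding l2_inner_bergman[OF mem] by (simp add: sum_distrib_right mult.assoc)
  also have "\<dots> = (\<Sum>b\<in>B. c b * (LINT p|lborel. b p * cnj (g p)))"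
    using B bergman_space_integrable_inner[OF D _ g]
    by (subst Bochner_Integration.integral_sum) (auto intro!: integrable_mult_right)
  also have "\<dots> = (\<Sum>b\<in>B. c b * l2_inner D b g)"
    using B by (intro sum.cong refl) (auto simp: l2_inner_bergman)
  finally show ?thesis .
qed

definition orthonormal_in :: "(complex^'n) set \<Rightarrow> (complex^'n \<Rightarrow> complex) set \<Rightarrow> bool" where
  "orthonormal_in D B \<longleftrightarrow> B \<subseteq> bergman_space D \<and> (\<forall>f\<in>B. \<forall>g\<in>B. l2_inner D f g = (if f = g then 1 else 0))"

lemma orthonormal_coeff:
  assumes D: "open D" and B: "finite B" "orthonormal_in D B" and b: "b \<in> B"
  shows "l2_inner D (\<lambda>p. \<Sum>b\<in>B. c b * b p) b = c b"
proof -
  have "l2_inner D (\<lambda>p. \<Sum>b\<in>B. c b * b p) b = (\<Sum>b'\<in>B. c b' * (if b' = b then 1 else 0))"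
    using B b by (subst l2_inner_sum_left[OF D]) (auto simp: orthonormal_in_def)
  also have "\<dots> = c b" using b B by (simp add: if_distrib cong: if_cong)
  finally show ?thesis .
qed

lemma orthonormal_expansion:
  assumes D: "open D" and B: "finite B" "orthonormal_in D B" and f: "f \<in> cspan B"
  shows "f p = (\<Sum>b\<in>B. l2_inner D f b * b p)"
proof -
  obtain c where c: "f = (\<lambda>p. \<Sum>b\<in>B. c b * b p)" using f B by (auto simp: cspan_finite_iff)
  have "l2_inner D f b = c b" if "b \<in> B" for b
    unfolding c by (rule orthonormal_coeff[OF D B that])
  then show ?thesis by (simp add: c)
qed

lemma l2_inner_definite_on_span:
  assumes D: "open D" and E: "finite E" "orthonormal_in D E" and f: "f \<in> cspan E" and 0: "l2_inner D f f = 0"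
  shows "f = 0"
proof -
  have sub: "cspan E \<subseteq> bergman_space D"
    using cfun.span_minimal[OF _ subspace_bergman_space[OF D]] E by (auto simp: orthonormal_in_def)
  have fe: "f = (\<lambda>p. \<Sum>e\<in>E. l2_inner D f e * e p)"
    using orthonormal_expansion[OF D E f] by (simp add: fun_eq_iff)
  have "l2_inner D f f = (\<Sum>e\<in>E. l2_inner D f e * l2_inner D e f)"
    using E f sub by (subst (1) fe, subst l2_inner_sum_left[OF D]) (auto simp: orthonormal_in_def)
  also have "\<dots> = of_real (\<Sum>e\<in>E. (cmod (l2_inner D f e))\<^sup>2)"
    by (simp add: l2_inner_cnj[of D f, symmetric] complex_norm_square del: of_real_power)
  finally have "(\<Sum>e\<in>E. (cmod (l2_inner D f e))\<^sup>2) = 0" using 0 by (metis of_real_eq_0_iff)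
  then have "\<forall>e\<in>E. l2_inner D f e = 0" using E by (simp add: sum_nonneg_eq_0_iff)
  then show ?thesis by (subst fe) (simp add: zero_fun_def)
qed

lemma orthonormal_independent:
  assumes D: "open D" and B: "orthonormal_in D B"
  shows "cfun.independent B"
  unfolding cfun.dependent_explicit
proof (clarify)
  fix t u v
  assume t: "finite t" "t \<subseteq> B" and s: "(\<Sum>v\<in>t. (\<lambda>p. u v * v p)) = 0" and v: "v \<in> t" "u v \<noteq> 0"
  have ot: "orthonormal_in D t" using B t unfolding orthonormal_in_def by (meson subset_iff order_trans)
  have "(\<lambda>p. \<Sum>v\<in>t. u v * v p) = (\<lambda>p. 0)"
    using s by (auto simp: fun_eq_iff sum_fun_apply)
  then have "u v = l2_inner D (\<lambda>p. 0) v"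
    using orthonormal_coeff[OF D t(1) ot v(1), of u] by simp
  also have "\<dots> = 0" by (simp add: l2_inner_def set_lebesgue_integral_def)
  finally show False using v by simp
qed

text \<open>The residual of the orthogonal projection of \<open>f\<close> to the span of \<open>B\<close> is no longer than \<open>f - g\<close> for any \<open>g\<close> in that span, by
  Pythagoras, so density makes its norm 0. That the residual itself is 0 follows from its expansion in \<open>E\<close>.\<close>

lemma complete_if_dense_in_finite_span:
  assumes D: "open D" and E: "finite E" "orthonormal_in D E" and H: "bergman_space D = cspan E"
    and B: "finite B" "orthonormal_in D B" and f: "f \<in> bergman_space D"
    and dense: "\<And>\<epsilon>. \<epsilon> > 0 \<Longrightarrow> \<exists>g\<in>cspan B. l2_norm D (f - g) < \<epsilon>"
  shows "f p = (\<Sum>b\<in>B. l2_inner D f b * b p)"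
proof -
  note sp = subspace_bergman_space[OF D]
  have BH: "B \<subseteq> bergman_space D" using B by (simp add: orthonormal_in_def)
  have spB: "cspan B \<subseteq> bergman_space D" by (rule cfun.span_minimal[OF BH sp])
  define s where "s = (\<lambda>p. \<Sum>b\<in>B. l2_inner D f b * b p)"
  have s: "s \<in> cspan B" unfolding cspan_finite_iff[OF B(1)] s_def by blast
  define r where "r = f - s"
  have r: "r \<in> bergman_space D" unfolding r_def using f s spB by (intro cfun.subspace_diff[OF sp]) auto
  have "l2_inner D r b = 0" if "b \<in> B" for b
    unfolding r_def using that BH f s spB orthonormal_coeff[OF D B that, of "l2_inner D f"]
    by (subst l2_inner_diff_left[OF D]) (auto simp: s_def)
  then have rb: "l2_inner D b r = 0" if "b \<in> B" for b
    using that l2_inner_cnj[of D r b] by simp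
  have rt: "l2_inner D t r = 0" if t: "t \<in> cspan B" for t
  proof -
    obtain c where "t = (\<lambda>p. \<Sum>b\<in>B. c b * b p)" using t B by (auto simp: cspan_finite_iff)
    then show ?thesis using l2_inner_sum_left[OF D B(1) BH r, of c] rb by simp
  qed
  have "l2_norm D r \<le> \<epsilon>" if \<epsilon>: "\<epsilon> > 0" for \<epsilon>
  proof -
    obtain g where g: "g \<in> cspan B" "l2_norm D (f - g) < \<epsilon>" using dense[OF \<epsilon>] by blast
    define t where "t = g - s"
    have t: "t \<in> cspan B" unfolding t_def using g s by (intro cfun.span_diff)
    have tH: "t \<in> bergman_space D" using t spB by auto
    have eq: "f - g = r - t" by (simp add: r_def t_def)
    have rtH: "r - t \<in> bergman_space D" by (rule cfun.subspace_diff[OF sp r tH])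
    have tr: "l2_inner D t r = 0" by (rule rt[OF t])
    have rt0: "l2_inner D r t = 0" using l2_inner_cnj[of D t r] tr by simp
    have 1: "l2_inner D (r - t) r = l2_inner D r r"
      using tr by (simp add: l2_inner_diff_left[OF D r tH r])
    have 2: "l2_inner D (r - t) t = - l2_inner D t t"
      using rt0 by (simp add: l2_inner_diff_left[OF D r tH tH])
    have "l2_inner D (r - t) (r - t) = l2_inner D r (r - t) - l2_inner D t (r - t)"
      by (rule l2_inner_diff_left[OF D r tH rtH])
    also have "\<dots> = cnj (l2_inner D (r - t) r) - cnj (l2_inner D (r - t) t)"
      by (simp add: l2_inner_cnj)
    also have "\<dots> = l2_inner D r r + l2_inner D t t"
      unfolding 1 2 by (simp add: l2_inner_cnj)
    finally have "complex_of_real ((l2_norm D (r - t))\<^sup>2) = of_real ((l2_norm D r)\<^sup>2 + (l2_norm D t)\<^sup>2)"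
      unfolding l2_inner_self by simp
    then have "(l2_norm D (r - t))\<^sup>2 = (l2_norm D r)\<^sup>2 + (l2_norm D t)\<^sup>2"
      by (simp only: of_real_eq_iff)
    then have "(l2_norm D r)\<^sup>2 \<le> (l2_norm D (r - t))\<^sup>2" by simp
    moreover have "0 \<le> l2_norm D (r - t)"
      unfolding l2_norm_def set_lebesgue_integral_def by (auto intro!: integral_nonneg_AE)
    ultimately have "l2_norm D r \<le> l2_norm D (r - t)" by (rule power2_le_imp_le)
    then show ?thesis using g eq by simp
  qed
  then have "l2_norm D r \<le> 0" by (rule field_le_epsilon) simp
  moreover have "0 \<le> l2_norm D r"
    unfolding l2_norm_def set_lebesgue_integral_def by (auto intro!: integral_nonneg_AE)
  ultimately have "l2_inner D r r = 0" by (simp add: l2_inner_self)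
  then have "r = 0" using l2_inner_definite_on_span[OF D E] r H by blast
  then have "f p = s p" unfolding r_def by (metis eq_iff_diff_eq_0)
  then show ?thesis by (simp add: s_def)
qed

text \<open>The orthonormal basis \<open>B\<close> selected in the definition of the kernel is independent, hence finite, and \<open>B\<close> and \<open>E\<close> expand in
  each other with conjugate coefficients; inserting one expansion into the other exchanges the two sums.\<close>

lemma bergman_kernel_finite_dimensional:
  fixes D :: "(complex^'n) set"
  assumes D: "open D" and E: "finite E" "orthonormal_in D E" and H: "bergman_space D = cspan E"
  shows "bergman_kernel D p = (\<Sum>e\<in>E. (cmod (e p))\<^sup>2)"
proof -
  have "l2_norm D (f - f) = 0" for f
    by (simp add: l2_norm_def set_lebesgue_integral_def)
  then have "bergman_onb D E"
    using E H unfolding bergman_onb_def orthonormal_in_def by force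
  define B where "B = (SOME B. bergman_onb D B)"
  have "bergman_onb D B" unfolding B_def by (rule someI[of _ E]) fact
  then have oB: "orthonormal_in D B" and dense: "\<And>f \<epsilon>. f \<in> bergman_space D \<Longrightarrow> \<epsilon> > 0 \<Longrightarrow> \<exists>g\<in>cspan B. l2_norm D (f - g) < \<epsilon>"
    by (auto simp: bergman_onb_def orthonormal_in_def)
  have EH: "E \<subseteq> bergman_space D" and BH: "B \<subseteq> bergman_space D" using E oB by (auto simp: orthonormal_in_def)
  have fB: "finite B"
    using cfun.independent_span_bound[OF E(1) orthonormal_independent[OF D oB]] BH H by auto
  have eB: "e p = (\<Sum>b\<in>B. l2_inner D e b * b p)" if "e \<in> E" for e
    using complete_if_dense_in_finite_span[OF D E H fB oB] dense that EH by blast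
  have bE: "b p = (\<Sum>e\<in>E. l2_inner D b e * e p)" if "b \<in> B" for b
    using orthonormal_expansion[OF D E] that BH H by blast
  have "complex_of_real (\<Sum>b\<in>B. (cmod (b p))\<^sup>2) = (\<Sum>b\<in>B. b p * cnj (b p))"
    by (simp add: complex_norm_square del: of_real_power)
  also have "\<dots> = (\<Sum>b\<in>B. \<Sum>e\<in>E. e p * cnj (l2_inner D e b * b p))"
    by (intro sum.cong refl) (subst bE, simp, simp add: sum_distrib_right sum_distrib_left l2_inner_cnj mult_ac)
  also have "\<dots> = (\<Sum>e\<in>E. e p * cnj (\<Sum>b\<in>B. l2_inner D e b * b p))"
    by (subst sum.swap) (simp add: sum_distrib_left)
  also have "\<dots> = (\<Sum>e\<in>E. e p * cnj (e p))"
    using eB by simp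
  also have "\<dots> = complex_of_real (\<Sum>e\<in>E. (cmod (e p))\<^sup>2)"
    by (simp add: complex_norm_square del: of_real_power)
  finally have "(\<Sum>b\<in>B. (cmod (b p))\<^sup>2) = (\<Sum>e\<in>E. (cmod (e p))\<^sup>2)"
    by (simp only: of_real_eq_iff)
  then show ?thesis
    using fB by (simp add: bergman_kernel_def B_def[symmetric])
qed

lemma l2_inner_scale: "l2_inner D (\<lambda>p. c * f p) (\<lambda>p. d * g p) = c * cnj d * l2_inner D f g"
proof -
  have "(\<lambda>p. indicator D p *\<^sub>R (c * f p * cnj (d * g p))) = (\<lambda>p. (c * cnj d) * (indicator D p *\<^sub>R (f p * cnj (g p))))"
    by (auto simp: fun_eq_iff indicator_def)
  then show ?thesis
    unfolding l2_inner_def set_lebesgue_integral_def by (simp only: integral_mult_right_zero)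
qed

lemma bergman_kernel_orthogonal_basis:
  fixes D :: "(complex^'n) set"
  assumes D: "open D" and S: "finite S" and H: "bergman_space D = cspan S"
    and orth: "\<And>f g. f \<in> S \<Longrightarrow> g \<in> S \<Longrightarrow> f \<noteq> g \<Longrightarrow> l2_inner D f g = 0"
    and nz: "\<And>f. f \<in> S \<Longrightarrow> 0 < l2_norm D f"
  shows "bergman_kernel D p = (\<Sum>f\<in>S. (cmod (f p))\<^sup>2 / (l2_norm D f)\<^sup>2)"
proof -
  define n where "n = (\<lambda>f p. complex_of_real (1 / l2_norm D f) * f p)"
  have inner: "l2_inner D (n f) (n g) = (if f = g then 1 else 0)" if "f \<in> S" "g \<in> S" for f g
  proof (cases "f = g")
    case True
    then show ?thesis using nz[OF that(1)]
      unfolding n_def l2_inner_scale by (simp add: l2_inner_self power2_eq_square)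
  next
    case False
    then show ?thesis using orth[OF that]
      unfolding n_def l2_inner_scale by simp
  qed
  have inj: "inj_on n S"
    by (rule inj_onI) (metis inner zero_neq_one)
  have span: "cspan (n ` S) = cspan S"
    unfolding cfun.span_eq
  proof
    show "n ` S \<subseteq> cspan S"
      unfolding n_def by (intro image_subsetI cfun.span_scale cfun.span_base)
    show "S \<subseteq> cspan (n ` S)"
    proof
      fix f assume f: "f \<in> S"
      have "(\<lambda>p. complex_of_real (l2_norm D f) * n f p) \<in> cspan (n ` S)"
        using f by (intro cfun.span_scale cfun.span_base) auto
      also have "(\<lambda>p. complex_of_real (l2_norm D f) * n f p) = f"
        using nz[OF f] by (simp add: n_def fun_eq_iff)
      finally show "f \<in> cspan (n ` S)" .
    qed
  qed
  have "orthonormal_in D (n ` S)"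
    unfolding orthonormal_in_def
  proof (intro conjI ballI)
    show "n ` S \<subseteq> bergman_space D" unfolding H span[symmetric] by (rule cfun.span_superset)
    show "l2_inner D e e' = (if e = e' then 1 else 0)" if "e \<in> n ` S" "e' \<in> n ` S" for e e'
      using that inner inj by (auto simp: inj_on_def)
  qed
  then have "bergman_kernel D p = (\<Sum>e\<in>n ` S. (cmod (e p))\<^sup>2)"
    using bergman_kernel_finite_dimensional[OF D, of "n ` S" p] S H span by simp
  also have "\<dots> = (\<Sum>f\<in>S. (cmod (n f p))\<^sup>2)"
    by (simp add: sum.reindex[OF inj])
  also have "\<dots> = (\<Sum>f\<in>S. (cmod (f p))\<^sup>2 / (l2_norm D f)\<^sup>2)"
  proof (rule sum.cong[OF refl])
    fix f assume "f \<in> S"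
    then show "(cmod (n f p))\<^sup>2 = (cmod (f p))\<^sup>2 / (l2_norm D f)\<^sup>2"
      using nz[of f] by (simp add: n_def norm_divide power_divide)
  qed
  finally show ?thesis .
qed

text \<open>A continuous function that is nonzero at \<open>p\<close> is nonzero on a ball around \<open>p\<close>, and balls have positive measure.\<close>

lemma l2_norm_pos:
  fixes D :: "(complex^'n) set"
  assumes D: "open D" and f: "f \<in> bergman_space D" and p: "p \<in> D" "f p \<noteq> 0"
  shows "0 < l2_norm D f"
proof -
  have eq: "(LINT p:D|lborel. (cmod (f p))\<^sup>2) = (LINT p|lborel. (cmod (f p))\<^sup>2)"
    unfolding set_lebesgue_integral_def
    by (rule Bochner_Integration.integral_cong) (use f in \<open>auto simp: indicator_def bergman_space_def\<close>)
  have "(LINT p|lborel. (cmod (f p))\<^sup>2) \<noteq> 0"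
  proof
    assume "(LINT p|lborel. (cmod (f p))\<^sup>2) = 0"
    then have "AE p in lborel. (cmod (f p))\<^sup>2 = 0"
      using integral_nonneg_eq_0_iff_AE[OF bergman_space_integrable[OF f]] by simp
    then have ae: "AE p in lborel. f p = 0" by simp
    have "continuous_on D f" using f holomorphic_vec_on_imp_continuous_on by (auto simp: bergman_space_def)
    then have "open (D \<inter> f -` (- {0}))"
      using D continuous_on_open_vimage[OF D, of f] by (metis Int_commute open_Compl closed_singleton)
    then obtain e where e: "e > 0" "ball p e \<subseteq> D \<inter> f -` (- {0})"
      using p by (metis Compl_iff IntI open_contains_ball singletonD vimageI2)
    have "AE q in lborel. q \<notin> ball p e" 
    proof (rule AE_mp[OF ae], rule AE_I2, rule impI)
      show "q \<notin> ball p e" if "f q = 0" for q using that e by auto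
    qed
    then have "emeasure lborel (ball p e) = 0"
      by (subst (asm) AE_iff_measurable[of "ball p e"]) auto
    then show False using e unit_ball_vol_pos[of "real DIM(complex^'n)"] by (simp add: emeasure_ball)
  qed
  moreover have "0 \<le> (LINT p|lborel. (cmod (f p))\<^sup>2)" by (intro integral_nonneg_AE) auto
  ultimately show ?thesis unfolding l2_norm_def eq by (simp add: order_less_le)
qed

lemma zero_ext_in_bergman_space:
  fixes D :: "(complex^'n) set"
  assumes D: "open D"
    and deriv: "\<And>p. p \<in> D \<Longrightarrow> \<exists>\<phi>'. (\<phi> has_derivative \<phi>') (at p) \<and> (\<forall>c v. \<phi>' (c *s v) = c * \<phi>' v)"
    and fin: "(\<integral>\<^sup>+p. ennreal ((cmod (\<phi> p))\<^sup>2) * indicator D p \<partial>lborel) < \<infinity>"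
  shows "zero_ext D \<phi> \<in> bergman_space D"
proof -
  have hol: "holomorphic_vec_on (zero_ext D \<phi>) D"
    unfolding holomorphic_vec_on_def
  proof
    fix p assume p: "p \<in> D"
    then obtain \<phi>' where \<phi>': "(\<phi> has_derivative \<phi>') (at p)" "\<And>c v. \<phi>' (c *s v) = c * \<phi>' v"
      using deriv by blast
    have "(zero_ext D \<phi> has_derivative \<phi>') (at p within D)"
      by (rule has_derivative_transform[OF p _ has_derivative_at_withinI[OF \<phi>'(1)]]) (simp add: zero_ext_def)
    then show "\<exists>f'. (zero_ext D \<phi> has_derivative f') (at p within D) \<and> (\<forall>c v. f' (c *s v) = c * f' v)"
      using \<phi>' by blast
  qed
  have "(\<lambda>p. indicator D p *\<^sub>R zero_ext D \<phi> p) \<in> borel_measurable borel"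
    using D holomorphic_vec_on_imp_continuous_on[OF hol] by (intro borel_measurable_continuous_on_indicator) auto
  then have "(\<lambda>p. (cmod (indicator D p *\<^sub>R zero_ext D \<phi> p))\<^sup>2) \<in> borel_measurable borel" by measurable
  also have "(\<lambda>p. (cmod (indicator D p *\<^sub>R zero_ext D \<phi> p))\<^sup>2) = (\<lambda>p. indicator D p *\<^sub>R (cmod (zero_ext D \<phi> p))\<^sup>2)"
    by (auto simp: fun_eq_iff indicator_def)
  finally have meas: "(\<lambda>p. indicator D p *\<^sub>R (cmod (zero_ext D \<phi> p))\<^sup>2) \<in> borel_measurable borel" .
  have "(\<integral>\<^sup>+p. ennreal (norm (indicator D p *\<^sub>R (cmod (zero_ext D \<phi> p))\<^sup>2)) \<partial>lborel)
     = (\<integral>\<^sup>+p. ennreal ((cmod (\<phi> p))\<^sup>2) * indicator D p \<partial>lborel)"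
    by (rule nn_integral_cong) (auto simp: indicator_def zero_ext_def)
  then have "set_integrable lborel D (\<lambda>p. (cmod (zero_ext D \<phi> p))\<^sup>2)"
    unfolding set_integrable_def using meas fin by (intro integrableI_bounded) auto
  with hol show ?thesis by (simp add: bergman_space_def zero_ext_def)
qed

section \<open>Curvature of metrics with quadratic kernel\<close>

text \<open>Existence of the two Wirtinger derivatives \<open>a = \<partial>f/\<partial>z\<^sub>j\<close> and \<open>b = \<partial>f/\<partial>(cnj z\<^sub>j)\<close>, encoded by the derivatives \<open>a + b\<close> and
  \<open>\<i> (a - b)\<close> in the directions of the real and imaginary axes. Each Wirtinger derivative involves both partial derivatives, so existence has
  to be tracked for the two together.\<close>

definition has_wirtinger :: "(complex^'n \<Rightarrow> complex) \<Rightarrow> 'n \<Rightarrow> complex^'n \<Rightarrow> complex \<Rightarrow> complex \<Rightarrow> bool" where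
  "has_wirtinger f j p a b \<longleftrightarrow>
     ((\<lambda>t. f (p + t *\<^sub>R axis j 1)) has_vector_derivative (a + b)) (at 0) \<and>
     ((\<lambda>t. f (p + t *\<^sub>R axis j \<i>)) has_vector_derivative (\<i> * (a - b))) (at 0)"

lemma has_wirtinger_imp:
  assumes "has_wirtinger f j p a b"
  shows "d_z j f p = a" "d_zbar j f p = b"
proof -
  have *: "partial_x j f p = a + b" "partial_y j f p = \<i> * (a - b)"
    using assms unfolding has_wirtinger_def partial_x_def partial_y_def
    by (auto intro: vector_derivative_at)
  show "d_z j f p = a" "d_zbar j f p = b"
    unfolding d_z_def d_zbar_def * by (simp_all add: algebra_simps)
qed

lemma has_wirtinger_const: "has_wirtinger (\<lambda>p. c) j p 0 0"
  by (simp add: has_wirtinger_def)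

lemma has_wirtinger_nth: "has_wirtinger (\<lambda>p. p $ i) j p (if i = j then 1 else 0) 0"
proof -
  have "((\<lambda>t. (p + t *\<^sub>R axis j c) $ i) has_vector_derivative (axis j c $ i)) (at 0)" for c :: complex
    by (auto intro!: derivative_eq_intros)
  from this[of 1] this[of \<i>] show ?thesis
    by (auto simp: has_wirtinger_def axis_def)
qed

lemma has_wirtinger_cnj_nth: "has_wirtinger (\<lambda>p. cnj (p $ i)) j p 0 (if i = j then 1 else 0)"
proof -
  have "((\<lambda>t. cnj ((p + t *\<^sub>R axis j c) $ i)) has_vector_derivative cnj (axis j c $ i)) (at 0)" for c :: complex
    by (rule bounded_linear.has_vector_derivative[OF bounded_linear_cnj]) (auto intro!: derivative_eq_intros)
  from this[of 1] this[of \<i>] show ?thesis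
    by (auto simp: has_wirtinger_def axis_def)
qed

lemma has_wirtinger_add:
  assumes "has_wirtinger f j p a b" "has_wirtinger g j p c d"
  shows "has_wirtinger (\<lambda>q. f q + g q) j p (a + c) (b + d)"
  using assms unfolding has_wirtinger_def
  by (auto intro!: has_vector_derivative_add[THEN has_vector_derivative_eq_rhs] simp: algebra_simps)

lemma has_wirtinger_minus:
  assumes "has_wirtinger f j p a b"
  shows "has_wirtinger (\<lambda>q. - f q) j p (- a) (- b)"
  using assms unfolding has_wirtinger_def
  by (auto intro!: has_vector_derivative_minus[THEN has_vector_derivative_eq_rhs] simp: algebra_simps)

lemma has_wirtinger_mult:
  assumes "has_wirtinger f j p a b" "has_wirtinger g j p c d"
  shows "has_wirtinger (\<lambda>q. f q * g q) j p (a * g p + f p * c) (b * g p + f p * d)"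
  using assms unfolding has_wirtinger_def
  by (auto intro!: has_vector_derivative_mult[THEN has_vector_derivative_eq_rhs] simp: algebra_simps)

lemma has_wirtinger_sum:
  assumes "\<And>i. i \<in> I \<Longrightarrow> has_wirtinger (f i) j p (a i) (b i)"
  shows "has_wirtinger (\<lambda>q. \<Sum>i\<in>I. f i q) j p (\<Sum>i\<in>I. a i) (\<Sum>i\<in>I. b i)"
  using assms
  by (induction I rule: infinite_finite_induct)
    (auto intro: has_wirtinger_const has_wirtinger_add)

lemma has_wirtinger_chain:
  assumes f: "has_wirtinger f j p a b" and h: "(h has_field_derivative h') (at (f p))"
  shows "has_wirtinger (\<lambda>q. h (f q)) j p (h' * a) (h' * b)"
proof -
  have "((\<lambda>t. h (f (p + t *\<^sub>R axis j c))) has_vector_derivative (d * h')) (at 0)"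
    if "((\<lambda>t. f (p + t *\<^sub>R axis j c)) has_vector_derivative d) (at 0)" for c d
    using field_vector_diff_chain_at[OF that] h by (simp add: o_def)
  then show ?thesis
    using f unfolding has_wirtinger_def by (fastforce simp: algebra_simps)
qed

lemma has_wirtinger_transform:
  fixes D :: "(complex^'n) set"
  assumes f: "has_wirtinger f j p a b" and D: "open D" "p \<in> D" and eq: "\<And>q. q \<in> D \<Longrightarrow> f q = g q"
  shows "has_wirtinger g j p a b"
proof -
  have "((\<lambda>t. g (p + t *\<^sub>R axis j c)) has_vector_derivative d) (at 0)"
    if "((\<lambda>t. f (p + t *\<^sub>R axis j c)) has_vector_derivative d) (at 0)" for c d
  proof (rule has_vector_derivative_transform_within_open[OF that])
    have "continuous_on UNIV (\<lambda>t. p + t *\<^sub>R axis j c)" by (intro continuous_intros)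
    then show "open ((\<lambda>t. p + t *\<^sub>R axis j c) -` D)" using D by (intro open_vimage)
  qed (use D eq in auto)
  then show ?thesis using f by (auto simp: has_wirtinger_def)
qed

lemma has_wirtinger_eq_rhs:
  "has_wirtinger f j p a b \<Longrightarrow> a = a' \<Longrightarrow> b = b' \<Longrightarrow> has_wirtinger f j p a' b'"
  by simp

lemma of_real_cmod_squared: "(complex_of_real (cmod x))\<^sup>2 = x * cnj x"
  by (metis complex_norm_square of_real_power)

text \<open>Such a kernel arises when the constant 1 and the coordinates form an orthogonal basis of the Bergman space; \<open>A\<close> and
  \<open>B j\<close> are then the inverse squares of their norms.\<close>

locale quadratic_kernel =
  fixes D :: "(complex^'n) set" and A :: real and B :: "'n \<Rightarrow> real"
  assumes open_D: "open D" and A: "A > 0" and B: "\<And>j. B j > 0"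
    and kernel: "\<And>q. q \<in> D \<Longrightarrow> bergman_kernel D q = A + (\<Sum>j\<in>UNIV. B j * (cmod (q $ j))\<^sup>2)"
begin

definition K :: "complex^'n \<Rightarrow> real" where
  "K q = A + (\<Sum>j\<in>UNIV. B j * (cmod (q $ j))\<^sup>2)"

text \<open>The functions \<open>\<phi> j\<close> and \<open>\<psi> j\<close> are the Wirtinger derivatives of \<open>log K\<close>, and \<open>G\<close> collects its mixed second derivatives.\<close>

definition \<phi> :: "'n \<Rightarrow> complex^'n \<Rightarrow> complex" where
  "\<phi> j q = of_real (B j) * cnj (q $ j) * inverse (of_real (K q))"

definition \<psi> :: "'n \<Rightarrow> complex^'n \<Rightarrow> complex" where
  "\<psi> j q = of_real (B j) * (q $ j) * inverse (of_real (K q))"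

definition G :: "'n \<Rightarrow> 'n \<Rightarrow> complex^'n \<Rightarrow> complex" where
  "G i j q = (if i = j then of_real (B i) else 0) * inverse (of_real (K q)) + - (\<phi> i q * \<psi> j q)"

lemma K_pos: "K q > 0"
  unfolding K_def using A B by (intro add_pos_nonneg sum_nonneg) (auto simp: less_imp_le)

lemma K_nz: "complex_of_real (K q) \<noteq> 0"
  using K_pos[of q] by simp

lemma has_wirtinger_K: "has_wirtinger (\<lambda>q. of_real (K q)) k p (of_real (B k) * cnj (p $ k)) (of_real (B k) * p $ k)"
proof -
  have eq: "(\<lambda>q. of_real (K q)) = (\<lambda>q. of_real A + (\<Sum>j\<in>UNIV. of_real (B j) * (q $ j * cnj (q $ j))))"
    by (simp add: K_def fun_eq_iff of_real_cmod_squared)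
  show ?thesis unfolding eq
  proof (rule has_wirtinger_eq_rhs[OF has_wirtinger_add[OF has_wirtinger_const has_wirtinger_sum]])
    show "has_wirtinger (\<lambda>q. of_real (B i) * (q $ i * cnj (q $ i))) k p
       (if i = k then of_real (B k) * cnj (p $ k) else 0) (if i = k then of_real (B k) * p $ k else 0)" for i
      by (rule has_wirtinger_eq_rhs[OF has_wirtinger_mult[OF has_wirtinger_const
              has_wirtinger_mult[OF has_wirtinger_nth has_wirtinger_cnj_nth]]]) auto
  qed auto
qed

lemma has_wirtinger_inverse_K:
  "has_wirtinger (\<lambda>q. inverse (of_real (K q))) k p
     (- (\<phi> k p * inverse (of_real (K p)))) (- (\<psi> k p * inverse (of_real (K p))))"
proof (rule has_wirtinger_eq_rhs[OF has_wirtinger_chain[OF has_wirtinger_K DERIV_inverse[OF K_nz]]])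
qed (auto simp: \<phi>_def \<psi>_def power2_eq_square)

lemma has_wirtinger_ln_K: "has_wirtinger (\<lambda>q. of_real (ln (K q))) k p (\<phi> k p) (\<psi> k p)"
proof -
  have eq: "(\<lambda>q. of_real (ln (K q))) = (\<lambda>q. Ln (of_real (K q)))"
    using K_pos by (simp add: Ln_of_real fun_eq_iff)
  have "(Ln has_field_derivative inverse (of_real (K p))) (at (of_real (K p)))"
    using K_pos[of p] by (intro has_field_derivative_Ln) auto
  from has_wirtinger_chain[OF has_wirtinger_K this] show ?thesis
    unfolding eq by (rule has_wirtinger_eq_rhs) (auto simp: \<phi>_def \<psi>_def)
qed

lemma has_wirtinger_\<phi>: "has_wirtinger (\<phi> k) l p (- (\<phi> k p * \<phi> l p)) (G k l p)"
proof -
  have eq: "\<phi> k = (\<lambda>q. of_real (B k) * cnj (q $ k) * inverse (of_real (K q)))"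
    by (simp add: \<phi>_def fun_eq_iff)
  show ?thesis unfolding eq
    by (rule has_wirtinger_eq_rhs[OF has_wirtinger_mult[OF has_wirtinger_mult[OF has_wirtinger_const
              has_wirtinger_cnj_nth] has_wirtinger_inverse_K]])
      (auto simp: G_def \<phi>_def)
qed

lemma has_wirtinger_\<psi>: "has_wirtinger (\<psi> k) l p (G l k p) (- (\<psi> k p * \<psi> l p))"
proof -
  have eq: "\<psi> k = (\<lambda>q. of_real (B k) * (q $ k) * inverse (of_real (K q)))"
    by (simp add: \<psi>_def fun_eq_iff)
  show ?thesis unfolding eq
    by (rule has_wirtinger_eq_rhs[OF has_wirtinger_mult[OF has_wirtinger_mult[OF has_wirtinger_const
              has_wirtinger_nth] has_wirtinger_inverse_K]])
      (auto simp: G_def \<psi>_def)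
qed

lemma has_wirtinger_G:
  "has_wirtinger (G i j) k p (- (\<phi> k p * G i j p + \<phi> i p * G k j p)) (- (\<psi> k p * G i j p + \<psi> j p * G i k p))"
proof -
  have eq: "G i j = (\<lambda>q. (if i = j then of_real (B i) else 0) * inverse (of_real (K q)) + - (\<phi> i q * \<psi> j q))"
    by (simp add: G_def fun_eq_iff)
  show ?thesis
    by (subst eq, rule has_wirtinger_eq_rhs[OF has_wirtinger_add[OF has_wirtinger_mult[OF has_wirtinger_const
              has_wirtinger_inverse_K] has_wirtinger_minus[OF has_wirtinger_mult[OF has_wirtinger_\<phi> has_wirtinger_\<psi>]]]])
      (simp_all add: eq algebra_simps)
qed

text \<open>The kernel is prescribed only on \<open>D\<close>, which suffices because derivatives at points of the open set \<open>D\<close> are local.\<close>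

lemma bergman_tensor_eq: "q \<in> D \<Longrightarrow> bergman_tensor D q $ a $ b = G a b q"
proof -
  assume q: "q \<in> D"
  have ln: "has_wirtinger (\<lambda>q. of_real (ln (bergman_kernel D q))) b q' (\<phi> b q') (\<psi> b q')" if "q' \<in> D" for q'
    by (rule has_wirtinger_transform[OF has_wirtinger_ln_K open_D that]) (simp add: kernel K_def)
  have "has_wirtinger (d_zbar b (\<lambda>q. of_real (ln (bergman_kernel D q)))) a q (G a b q) (- (\<psi> b q * \<psi> a q))"
    by (rule has_wirtinger_transform[OF has_wirtinger_\<psi> open_D q]) (simp add: has_wirtinger_imp(2)[OF ln])
  then show ?thesis by (simp add: bergman_tensor_def has_wirtinger_imp(1))
qed

text \<open>The matrix is a diagonal one minus one of rank 1, and the two parts give the two terms.\<close>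

lemma metric_form_eq:
  assumes "p \<in> D"
  shows "metric_form (bergman_tensor D) p X =
    of_real ((\<Sum>i\<in>UNIV. B i * (cmod (X $ i))\<^sup>2) / K p - (cmod (\<Sum>i\<in>UNIV. of_real (B i) * cnj (p $ i) * X $ i))\<^sup>2 / (K p)\<^sup>2)"
proof -
  let ?k = "inverse (complex_of_real (K p))"
  have "metric_form (bergman_tensor D) p X
     = (\<Sum>i\<in>UNIV. \<Sum>j\<in>UNIV. (if i = j then of_real (B i) * ?k * X $ i * cnj (X $ i) else 0) - (\<phi> i p * X $ i) * (\<psi> j p * cnj (X $ j)))"
    unfolding metric_form_def bergman_tensor_eq[OF assms]
    by (intro sum.cong refl) (auto simp: G_def algebra_simps)
  also have "\<dots> = (\<Sum>i\<in>UNIV. of_real (B i) * ?k * X $ i * cnj (X $ i)) - (\<Sum>i\<in>UNIV. \<phi> i p * X $ i) * (\<Sum>j\<in>UNIV. \<psi> j p * cnj (X $ j))"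
    by (simp add: sum_subtractf sum_product)
  also have "(\<Sum>i\<in>UNIV. of_real (B i) * ?k * X $ i * cnj (X $ i)) = of_real ((\<Sum>i\<in>UNIV. B i * (cmod (X $ i))\<^sup>2) / K p)"
    by (simp add: of_real_cmod_squared sum_distrib_right divide_inverse mult_ac) (simp add: sum_distrib_left mult_ac)
  also have "(\<Sum>j\<in>UNIV. \<psi> j p * cnj (X $ j)) = cnj (\<Sum>i\<in>UNIV. \<phi> i p * X $ i)"
    by (simp add: \<phi>_def \<psi>_def)
  also have "(\<Sum>i\<in>UNIV. \<phi> i p * X $ i) = (\<Sum>i\<in>UNIV. of_real (B i) * cnj (p $ i) * X $ i) / of_real (K p)"
    by (simp add: \<phi>_def sum_distrib_left divide_inverse mult_ac)
  finally show ?thesis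
    unfolding complex_norm_square[symmetric] by (simp add: norm_divide power_divide)
qed

text \<open>By Cauchy-Schwarz with weights \<open>B\<close>, the subtracted term is at most \<open>(K - A) / K\<close> times the first one; the constant
  term \<open>A\<close> of the kernel makes the difference positive.\<close>

lemma metric_pos_def: "metric_pos_def_on (bergman_tensor D) D"
  unfolding metric_pos_def_on_def
proof (intro ballI allI impI)
  fix p X assume p: "p \<in> D" and X: "X \<noteq> (0 :: complex^'n)"
  let ?S = "\<Sum>i\<in>UNIV. B i * (cmod (X $ i))\<^sup>2"
  let ?c = "cmod (\<Sum>i\<in>UNIV. of_real (B i) * cnj (p $ i) * X $ i)"
  obtain i where i: "X $ i \<noteq> 0" using X by (auto simp: vec_eq_iff)
  have S: "?S > 0"
    using i B by (intro sum_pos2[of _ i]) (auto simp: less_imp_le)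
  have "?c \<le> (\<Sum>i\<in>UNIV. (sqrt (B i) * cmod (p $ i)) * (sqrt (B i) * cmod (X $ i)))"
  proof (rule order_trans[OF norm_sum sum_mono])
    fix i
    show "cmod (of_real (B i) * cnj (p $ i) * X $ i) \<le> (sqrt (B i) * cmod (p $ i)) * (sqrt (B i) * cmod (X $ i))"
    proof -
      have *: "(sqrt (B i) * cmod (p $ i)) * (sqrt (B i) * cmod (X $ i)) = (sqrt (B i) * sqrt (B i)) * cmod (p $ i) * cmod (X $ i)"
        by (simp only: mult_ac)
      show ?thesis unfolding * using B[of i] by (simp add: norm_mult)
    qed
  qed
  then have "?c\<^sup>2 \<le> (\<Sum>i\<in>UNIV. (sqrt (B i) * cmod (p $ i)) * (sqrt (B i) * cmod (X $ i)))\<^sup>2"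
    by (intro power_mono) auto
  also have "\<dots> \<le> (\<Sum>i\<in>UNIV. (sqrt (B i) * cmod (p $ i))\<^sup>2) * (\<Sum>i\<in>UNIV. (sqrt (B i) * cmod (X $ i))\<^sup>2)"
    by (rule Cauchy_Schwarz_ineq_sum)
  also have "\<dots> = (K p - A) * ?S"
    using B by (simp add: K_def power_mult_distrib less_imp_le)
  finally have c: "?c\<^sup>2 \<le> (K p - A) * ?S" .
  have "0 < A * ?S / (K p)\<^sup>2" using A S K_pos[of p] by simp
  also have "\<dots> = ?S / K p - (K p - A) * ?S / (K p)\<^sup>2"
    using K_pos[of p] by (simp add: field_simps power2_eq_square)
  also have "\<dots> \<le> ?S / K p - ?c\<^sup>2 / (K p)\<^sup>2"
    using c by (intro diff_left_mono divide_right_mono) auto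
  finally show "metric_form (bergman_tensor D) p X \<in> \<real> \<and> 0 < Re (metric_form (bergman_tensor D) p X)"
    unfolding metric_form_eq[OF p] by simp
qed

lemma has_bergman_metric: "has_bergman_metric D"
  unfolding has_bergman_metric_def
  using metric_pos_def K_pos by (auto simp: kernel K_def)

lemma matrix_inv_bergman_tensor:
  assumes p: "p \<in> D"
  shows "matrix_inv (bergman_tensor D p) ** bergman_tensor D p = mat 1"
proof -
  let ?M = "bergman_tensor D p"
  have "inj ((*v) ?M)"
  proof (subst matrix_left_invertible_injective[symmetric], subst matrix_left_invertible_ker, intro allI impI)
    fix x assume x: "?M *v x = 0"
    have "metric_form (bergman_tensor D) p (\<chi> i. cnj (x $ i)) = (\<Sum>i\<in>UNIV. cnj (x $ i) * (?M *v x) $ i)"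
      unfolding metric_form_def by (simp add: matrix_vector_mult_def sum_distrib_left mult_ac)
    then have "metric_form (bergman_tensor D) p (\<chi> i. cnj (x $ i)) = 0" using x by simp
    then have "(\<chi> i. cnj (x $ i)) = (0 :: complex^'n)"
      using metric_pos_def p unfolding metric_pos_def_on_def by fastforce
    then show "x = 0" by (simp add: vec_eq_iff)
  qed
  then have "invertible ?M"
    using matrix_left_invertible_injective invertible_left_inverse by blast
  then have "\<exists>N. ?M ** N = mat 1 \<and> N ** ?M = mat 1"
    by (simp add: invertible_def)
  then show ?thesis
    unfolding matrix_inv_def by (rule someI2_ex) simp
qed

text \<open>The rules \<open>\<partial>\<^sub>k G\<^sub>i\<^sub>j = - (\<phi>\<^sub>k G\<^sub>i\<^sub>j + \<phi>\<^sub>i G\<^sub>k\<^sub>j)\<close> and their conjugates make the inverse metric cancel against one factor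
  \<open>G\<close>, so that its entries are never needed. What is left of the second derivatives is \<open>G\<^sub>i\<^sub>j G\<^sub>k\<^sub>l + G\<^sub>i\<^sub>l G\<^sub>k\<^sub>j\<close>, the curvature tensor of a
  space of constant holomorphic sectional curvature 2.\<close>

lemma curvature_eq:
  assumes p: "p \<in> D"
  shows "curvature (bergman_tensor D) p i j k l = G i j p * G k l p + G i l p * G k j p"
proof -
  have T: "has_wirtinger (\<lambda>q. bergman_tensor D q $ i $ j) k q
      (- (\<phi> k q * G i j q + \<phi> i q * G k j q)) (- (\<psi> k q * G i j q + \<psi> j q * G i k q))" if "q \<in> D" for i j k q
    by (rule has_wirtinger_transform[OF has_wirtinger_G open_D that]) (simp add: bergman_tensor_eq)
  note dT = has_wirtinger_imp[OF T]
  have TT: "has_wirtinger (d_zbar l (\<lambda>q. bergman_tensor D q $ i $ j)) k p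
      (- ((G k l p * G i j p + \<psi> l p * - (\<phi> k p * G i j p + \<phi> i p * G k j p))
        + (G k j p * G i l p + \<psi> j p * - (\<phi> k p * G i l p + \<phi> i p * G k l p))))
      (- ((- (\<psi> l p * \<psi> k p) * G i j p + \<psi> l p * - (\<psi> k p * G i j p + \<psi> j p * G i k p))
        + (- (\<psi> j p * \<psi> k p) * G i l p + \<psi> j p * - (\<psi> k p * G i l p + \<psi> l p * G i k p))))"
    by (rule has_wirtinger_transform[OF has_wirtinger_minus[OF has_wirtinger_add[OF
              has_wirtinger_mult[OF has_wirtinger_\<psi> has_wirtinger_G] has_wirtinger_mult[OF has_wirtinger_\<psi> has_wirtinger_G]]] open_D p])
      (simp add: dT)
  define dG where "dG = (\<lambda>i b. - (\<phi> k p * G i b p + \<phi> i p * G k b p))"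
  let ?N = "matrix_inv (bergman_tensor D p)"
  have inv: "(\<Sum>a\<in>UNIV. ?N $ b $ a * G a c p) = (if b = c then 1 else 0)" for b c
    using matrix_inv_bergman_tensor[OF p]
    by (simp add: vec_eq_iff matrix_matrix_mult_def mat_def bergman_tensor_eq[OF p])
  have "(\<Sum>a\<in>UNIV. \<Sum>b\<in>UNIV. inv_metric (bergman_tensor D) p a b * d_z k (\<lambda>q. bergman_tensor D q $ i $ b) p * d_zbar l (\<lambda>q. bergman_tensor D q $ a $ j) p)
     = (\<Sum>b\<in>UNIV. \<Sum>a\<in>UNIV. - \<psi> l p * dG i b * (?N $ b $ a * G a j p) + - \<psi> j p * dG i b * (?N $ b $ a * G a l p))"
    unfolding dT[OF p] inv_metric_def
    by (subst sum.swap, intro sum.cong refl) (simp add: dG_def algebra_simps)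
  also have "\<dots> = (\<Sum>b\<in>UNIV. - \<psi> l p * dG i b * (if b = j then 1 else 0) + - \<psi> j p * dG i b * (if b = l then 1 else 0))"
    by (simp only: sum.distrib sum_distrib_left[symmetric] inv)
  also have "\<dots> = - \<psi> l p * dG i j - \<psi> j p * dG i l"
  proof -
    have delta: "(\<Sum>b\<in>UNIV. h b * (if b = c then 1 else 0)) = h c" for h :: "'n \<Rightarrow> complex" and c
      by (simp add: if_distrib cong: if_cong)
    show ?thesis unfolding sum.distrib delta by simp
  qed
  finally show ?thesis
    unfolding curvature_def has_wirtinger_imp(1)[OF TT] by (simp add: dG_def algebra_simps)
qed

lemma hol_sect_curv_eq_2:
  assumes p: "p \<in> D" and X: "X \<noteq> 0"
  shows "hol_sect_curv (bergman_tensor D) p X = 2"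
proof -
  define Q where "Q = metric_form (bergman_tensor D) p X"
  have Q: "Q = (\<Sum>i\<in>UNIV. \<Sum>j\<in>UNIV. G i j p * X $ i * cnj (X $ j))"
    by (simp add: Q_def metric_form_def bergman_tensor_eq[OF p])
  have 1: "(\<Sum>i\<in>UNIV. \<Sum>j\<in>UNIV. \<Sum>k\<in>UNIV. \<Sum>l\<in>UNIV. (G i j p * X $ i * cnj (X $ j)) * (G k l p * X $ k * cnj (X $ l))) = Q * Q"
    unfolding Q by (simp only: sum_distrib_left[symmetric] sum_distrib_right[symmetric])
  have 2: "(\<Sum>i\<in>UNIV. \<Sum>j\<in>UNIV. \<Sum>k\<in>UNIV. \<Sum>l\<in>UNIV. (G i l p * X $ i * cnj (X $ l)) * (G k j p * X $ k * cnj (X $ j))) = Q * Q"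
  proof -
    have "(\<Sum>i\<in>UNIV. \<Sum>j\<in>UNIV. \<Sum>k\<in>UNIV. \<Sum>l\<in>UNIV. (G i l p * X $ i * cnj (X $ l)) * (G k j p * X $ k * cnj (X $ j)))
       = (\<Sum>i\<in>UNIV. (\<Sum>l\<in>UNIV. G i l p * X $ i * cnj (X $ l)) * (\<Sum>j\<in>UNIV. \<Sum>k\<in>UNIV. G k j p * X $ k * cnj (X $ j)))"
      by (simp only: sum_distrib_left[symmetric] sum_distrib_right[symmetric])
    also have "(\<Sum>j\<in>UNIV. \<Sum>k\<in>UNIV. G k j p * X $ k * cnj (X $ j)) = Q"
      unfolding Q by (rule sum.swap)
    finally show ?thesis by (simp add: Q sum_distrib_right)
  qed
  have "(\<Sum>i\<in>UNIV. \<Sum>j\<in>UNIV. \<Sum>k\<in>UNIV. \<Sum>l\<in>UNIV. curvature (bergman_tensor D) p i j k l * X $ i * cnj (X $ j) * X $ k * cnj (X $ l))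
     = (\<Sum>i\<in>UNIV. \<Sum>j\<in>UNIV. \<Sum>k\<in>UNIV. \<Sum>l\<in>UNIV. (G i j p * X $ i * cnj (X $ j)) * (G k l p * X $ k * cnj (X $ l))
         + (G i l p * X $ i * cnj (X $ l)) * (G k j p * X $ k * cnj (X $ j)))"
    unfolding curvature_eq[OF p] by (intro sum.cong refl) (simp add: algebra_simps)
  also have "\<dots> = 2 * Q\<^sup>2"
    unfolding sum.distrib 1 2 by (simp add: power2_eq_square)
  finally have "hol_sect_curv (bergman_tensor D) p X = 2 * Q\<^sup>2 / Q\<^sup>2"
    by (simp add: hol_sect_curv_def Q_def)
  moreover have "Q \<noteq> 0"
    using metric_pos_def p X unfolding metric_pos_def_on_def Q_def by force
  ultimately show ?thesis by simp
qed

end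

section \<open>The Bergman space and the Bergman metric of the domain\<close>

lemma zero_ext_D_alpha_in_bergman_space:
  fixes \<phi> :: "complex^2 \<Rightarrow> complex"
  assumes \<alpha>: "2 < \<alpha>"
    and deriv: "\<And>p. \<exists>\<phi>'. (\<phi> has_derivative \<phi>') (at p) \<and> (\<forall>c v. \<phi>' (c *s v) = c * \<phi>' v)"
    and le: "\<And>p. p \<in> D_alpha \<alpha> \<Longrightarrow> (cmod (\<phi> p))\<^sup>2 \<le> 1 + (cmod (p $ 1))\<^sup>2"
  shows "zero_ext (D_alpha \<alpha>) \<phi> \<in> bergman_space (D_alpha \<alpha>)"
proof (rule zero_ext_in_bergman_space[OF open_D_alpha deriv])
  have "(\<integral>\<^sup>+p. ennreal ((cmod (\<phi> p))\<^sup>2) * indicator (D_alpha \<alpha>) p \<partial>lborel)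
     \<le> (\<integral>\<^sup>+p. ennreal (1 + (cmod (p $ 1))\<^sup>2) * indicator (D_alpha \<alpha>) p \<partial>lborel)"
    by (rule nn_integral_mono) (use le in \<open>auto simp: indicator_def intro!: ennreal_leI simp del: ennreal_plus\<close>)
  also have "\<dots> < \<infinity>" by (rule nn_integral_quadratic_D_alpha_finite[OF \<alpha>])
  finally show "(\<integral>\<^sup>+p. ennreal ((cmod (\<phi> p))\<^sup>2) * indicator (D_alpha \<alpha>) p \<partial>lborel) < \<infinity>" .
qed

lemma has_derivative_nth_complex:
  "\<exists>\<phi>'. ((\<lambda>p::complex^'n. p $ i) has_derivative \<phi>') (at p) \<and> (\<forall>c v. \<phi>' (c *s v) = c * \<phi>' v)"
  by (rule exI[of _ "\<lambda>v. v $ i"]) (auto intro!: bounded_linear_imp_has_derivative bounded_linear_vec_nth)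

text \<open>All three are bounded by \<open>sqrt (1 + \<bar>z\<bar>\<^sup>2)\<close>; for \<open>w\<close> this uses \<open>\<bar>w\<bar>\<^sup>2 < \<bar>z\<bar>\<^sup>2 + 1\<close> on the domain.\<close>

lemma coordinates_in_bergman_space:
  assumes \<alpha>: "2 < \<alpha>"
  shows "zero_ext (D_alpha \<alpha>) (\<lambda>p. 1) \<in> bergman_space (D_alpha \<alpha>)"
    and "zero_ext (D_alpha \<alpha>) (\<lambda>p. p $ 1) \<in> bergman_space (D_alpha \<alpha>)"
    and "zero_ext (D_alpha \<alpha>) (\<lambda>p. p $ 2) \<in> bergman_space (D_alpha \<alpha>)"
proof -
  show "zero_ext (D_alpha \<alpha>) (\<lambda>p. 1) \<in> bergman_space (D_alpha \<alpha>)"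
    by (rule zero_ext_D_alpha_in_bergman_space[OF \<alpha>]) (auto intro!: exI[of _ "\<lambda>_. 0"])
  show "zero_ext (D_alpha \<alpha>) (\<lambda>p. p $ 1) \<in> bergman_space (D_alpha \<alpha>)"
    by (rule zero_ext_D_alpha_in_bergman_space[OF \<alpha> has_derivative_nth_complex]) auto
  show "zero_ext (D_alpha \<alpha>) (\<lambda>p. p $ 2) \<in> bergman_space (D_alpha \<alpha>)"
  proof (rule zero_ext_D_alpha_in_bergman_space[OF \<alpha> has_derivative_nth_complex])
    fix p assume "p \<in> D_alpha \<alpha>"
    then have "\<bar>(cmod (p $ 2))\<^sup>2 - (cmod (p $ 1))\<^sup>2\<bar> < r_fun p powr (- \<alpha>)" by (simp add: D_alpha_def)
    also have "\<dots> \<le> 1" using r_fun_ge_1 \<alpha> by (intro powr_le_1_neg) auto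
    finally show "(cmod (p $ 2))\<^sup>2 \<le> 1 + (cmod (p $ 1))\<^sup>2" by linarith
  qed
qed

lemma bergman_space_D_alpha:
  assumes \<alpha>: "2 < \<alpha>" "\<alpha> < 3"
  shows "bergman_space (D_alpha \<alpha>) =
     cspan {zero_ext (D_alpha \<alpha>) (\<lambda>p. 1), zero_ext (D_alpha \<alpha>) (\<lambda>p. p $ 1), zero_ext (D_alpha \<alpha>) (\<lambda>p. p $ 2)}"
    (is "_ = cspan ?S")
proof
  show "cspan ?S \<subseteq> bergman_space (D_alpha \<alpha>)"
    using coordinates_in_bergman_space[OF \<alpha>(1)]
    by (intro cfun.span_minimal subspace_bergman_space open_D_alpha) auto
  show "bergman_space (D_alpha \<alpha>) \<subseteq> cspan ?S"
  proof
    fix f assume f: "f \<in> bergman_space (D_alpha \<alpha>)"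
    obtain a b c where abc: "\<forall>p\<in>D_alpha \<alpha>. f p = a + b * p $ 1 + c * p $ 2"
      using square_integrable_holomorphic_affine[OF \<alpha> f] by blast
    have "f = (\<lambda>p. a * zero_ext (D_alpha \<alpha>) (\<lambda>p. 1) p) + (\<lambda>p. b * zero_ext (D_alpha \<alpha>) (\<lambda>p. p $ 1) p)
          + (\<lambda>p. c * zero_ext (D_alpha \<alpha>) (\<lambda>p. p $ 2) p)"
      using abc f by (auto simp: fun_eq_iff zero_ext_def bergman_space_def)
    also have "\<dots> \<in> cspan ?S"
      by (intro cfun.span_add cfun.span_scale cfun.span_base) auto
    finally show "f \<in> cspan ?S" .
  qed
qed

text \<open>Substituting \<open>(a z, b w)\<close> preserves Lebesgue measure, so the integral equals its own negative.\<close>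

lemma integral_odd_eq_0:
  fixes F :: "complex^2 \<Rightarrow> complex"
  assumes F: "F \<in> borel_measurable borel" and ab: "cmod a = 1" "cmod b = 1"
    and odd: "\<And>p. F (vec2 (a * p $ 1) (b * p $ 2)) = - F p"
  shows "(LINT p|lborel. F p) = 0"
proof -
  have "(LINT p|lborel. F p) = (LINT p|distr lborel borel (\<lambda>p::complex^2. vec2 (a * p $ 1) (b * p $ 2)). F p)"
    by (simp only: lborel_distr_torus[OF ab])
  also have "\<dots> = (LINT p|lborel. - F p)"
    using F by (subst integral_distr) (auto simp: odd)
  finally show ?thesis by simp
qed

lemma vec2_in_D_alpha_iff:
  assumes "cmod a = 1" "cmod b = 1"
  shows "vec2 (a * p $ 1) (b * p $ 2) \<in> D_alpha \<alpha> \<longleftrightarrow> p \<in> D_alpha \<alpha>"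
  using assms by (simp add: D_alpha_def r_fun_def norm_mult)

lemma coordinates_orthogonal:
  assumes \<alpha>: "2 < \<alpha>"
  defines "b0 \<equiv> zero_ext (D_alpha \<alpha>) (\<lambda>p. 1)" and "b1 \<equiv> zero_ext (D_alpha \<alpha>) (\<lambda>p. p $ 1)"
    and "b2 \<equiv> zero_ext (D_alpha \<alpha>) (\<lambda>p. p $ 2)"
  shows "l2_inner (D_alpha \<alpha>) b0 b1 = 0" "l2_inner (D_alpha \<alpha>) b0 b2 = 0" "l2_inner (D_alpha \<alpha>) b1 b2 = 0"
proof -
  note mem = coordinates_in_bergman_space[OF \<alpha>, folded b0_def b1_def b2_def]
  note meas = borel_measurable_integrable[OF bergman_space_integrable_inner[OF open_D_alpha], simplified]
  note inD = vec2_in_D_alpha_iff[of "-1" 1 _ \<alpha>, simplified] vec2_in_D_alpha_iff[of 1 "-1" _ \<alpha>, simplified]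
  show "l2_inner (D_alpha \<alpha>) b0 b1 = 0"
    unfolding l2_inner_bergman[OF mem(1)]
    by (rule integral_odd_eq_0[OF meas[OF mem(1,2)], of "-1" 1]) (simp_all add: b0_def b1_def zero_ext_def inD)
  show "l2_inner (D_alpha \<alpha>) b0 b2 = 0"
    unfolding l2_inner_bergman[OF mem(1)]
    by (rule integral_odd_eq_0[OF meas[OF mem(1,3)], of 1 "-1"]) (simp_all add: b0_def b2_def zero_ext_def inD)
  show "l2_inner (D_alpha \<alpha>) b1 b2 = 0"
    unfolding l2_inner_bergman[OF mem(2)]
    by (rule integral_odd_eq_0[OF meas[OF mem(2,3)], of "-1" 1]) (simp_all add: b1_def b2_def zero_ext_def inD)
qed

lemma bergman_kernel_D_alpha:
  assumes \<alpha>: "2 < \<alpha>" "\<alpha> < 3"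
  obtains A B1 B2 where "A > 0" "B1 > 0" "B2 > 0"
    "\<And>p. p \<in> D_alpha \<alpha> \<Longrightarrow> bergman_kernel (D_alpha \<alpha>) p = A + B1 * (cmod (p $ 1))\<^sup>2 + B2 * (cmod (p $ 2))\<^sup>2"
proof -
  let ?D = "D_alpha \<alpha>"
  define b0 b1 b2 where "b0 = zero_ext ?D (\<lambda>p. 1)" and "b1 = zero_ext ?D (\<lambda>p. p $ 1)" and "b2 = zero_ext ?D (\<lambda>p. p $ 2)"
  note b = b0_def b1_def b2_def
  note mem = coordinates_in_bergman_space[OF \<alpha>(1), folded b]
  note orth = coordinates_orthogonal[OF \<alpha>(1), folded b]
  have u: "vec2 1 (-1) \<in> ?D" by (rule diagonal_in_D_alpha) simp
  have val: "b0 (vec2 1 (-1)) = 1" "b1 (vec2 1 (-1)) = 1" "b2 (vec2 1 (-1)) = -1" "b0 0 = 1" "b1 0 = 0" "b2 0 = 0"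
    using u zero_in_D_alpha[of \<alpha>] by (simp_all add: b zero_ext_def)
  have pos: "0 < l2_norm ?D b0" "0 < l2_norm ?D b1" "0 < l2_norm ?D b2"
    by (rule l2_norm_pos[OF open_D_alpha _ u]; simp add: mem val)+
  have dist: "b0 \<noteq> b1" "b0 \<noteq> b2" "b1 \<noteq> b2" using val by (metis one_neq_neg_one zero_neq_one)+
  have "l2_inner ?D f g = 0" if "f \<in> {b0, b1, b2}" "g \<in> {b0, b1, b2}" "f \<noteq> g" for f g
    using that orth l2_inner_cnj[of ?D b0 b1] l2_inner_cnj[of ?D b0 b2] l2_inner_cnj[of ?D b1 b2] by auto
  then have K: "bergman_kernel ?D p = (\<Sum>f\<in>{b0, b1, b2}. (cmod (f p))\<^sup>2 / (l2_norm ?D f)\<^sup>2)" for p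
    using pos by (intro bergman_kernel_orthogonal_basis open_D_alpha bergman_space_D_alpha[OF \<alpha>, folded b]) auto
  show thesis
  proof (rule that)
    show "0 < 1 / (l2_norm ?D b0)\<^sup>2" "0 < 1 / (l2_norm ?D b1)\<^sup>2" "0 < 1 / (l2_norm ?D b2)\<^sup>2"
      using pos by simp_all
    show "bergman_kernel ?D p = 1 / (l2_norm ?D b0)\<^sup>2 + 1 / (l2_norm ?D b1)\<^sup>2 * (cmod (p $ 1))\<^sup>2
        + 1 / (l2_norm ?D b2)\<^sup>2 * (cmod (p $ 2))\<^sup>2" if "p \<in> ?D" for p
    proof -
      have "b0 p = 1" "b1 p = p $ 1" "b2 p = p $ 2" using that by (simp_all add: b zero_ext_def)
      then show ?thesis unfolding K using dist by simp
    qed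
  qed
qed

theorem theorem3p1:
  fixes \<alpha> :: real
  assumes "2 < \<alpha>" and "\<alpha> < 3"
  shows "bergman_space (D_alpha \<alpha>) =
           cspan {zero_ext (D_alpha \<alpha>) (\<lambda>p. 1),
                  zero_ext (D_alpha \<alpha>) (\<lambda>p. p $ 1),
                  zero_ext (D_alpha \<alpha>) (\<lambda>p. p $ 2)} \<and>
         has_bergman_metric (D_alpha \<alpha>) \<and>
         (\<forall>p\<in>D_alpha \<alpha>. \<forall>X. X \<noteq> 0 \<longrightarrow> hol_sect_curv (bergman_tensor (D_alpha \<alpha>)) p X = 2)"
proof -
  obtain A B1 B2 where AB: "A > 0" "B1 > 0" "B2 > 0"
    and K: "\<And>p. p \<in> D_alpha \<alpha> \<Longrightarrow> bergman_kernel (D_alpha \<alpha>) p = A + B1 * (cmod (p $ 1))\<^sup>2 + B2 * (cmod (p $ 2))\<^sup>2"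
    by (rule bergman_kernel_D_alpha[OF assms]) blast
  interpret quadratic_kernel "D_alpha \<alpha>" A "\<lambda>j. if j = 1 then B1 else B2"
    by unfold_locales (use AB K open_D_alpha in \<open>auto simp: sum_2\<close>)
  show ?thesis
    using bergman_space_D_alpha[OF assms] has_bergman_metric hol_sect_curv_eq_2 by blast
qed

end
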